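(* Let $f$ be a quadratic post-critically finite polynomial over $\mathbb C$ with critical point $c$ and post-critical orbit $P_c=\{f^m(c)\mid m\ge1\}$, and let $\mathcal G(\partial T,\mathrm{IMG}(f),\Phi)$ be the germinal groupoid associated to the action of the discrete iterated monodromy group $\mathrm{IMG}(f)$ on the boundary $\partial T$ of the binary tree $T$. Then $\mathcal G(\partial T,\mathrm{IMG}(f),\Phi)$ has non-Hausdorff topology if and only if the post-critical orbit $P_c$ is strictly pre-periodic and $P_c$ has cardinality at least $3$. Otherwise $\mathcal G(\partial T,\mathrm{IMG}(f),\Phi)$ has Hausdorff topology.
   Context: $f:\mathbb C\to\mathbb C$ is a polynomial of degree $2$; $c\in\mathbb C$ is its unique critical point; $f^m$ is the $m$-th iterate. $f$ is post-critically finite (PCF) if $P_c$ is finite. Then either $P_c$ is a single periodic cycle (containing $c$), or $P_c$ is strictly pre-periodic, i.e. $c$ is not periodic but there are $k,m\ge1$ with $f^{n+k}(c)=f^n(c)$ for all $n\ge m$. Iterated monodromy group: choose a base point $t\in\mathbb C\setminus P_c$. Then $T=\bigsqcup_{n\ge0}f^{-n}(t)$, with $z\in f^{-(n+1)}(t)$ joined by an edge to $f(z)\in f^{-n}(t)$, is a binary rooted tree with root $t$. The fundamental group $\pi_1(\mathbb C\setminus P_c,t)$ acts on each level $f^{-n}(t)$ by the monodromy action of the covering $f^n:\mathbb C\setminus f^{-n}(P_c)\to\mathbb C\setminus P_c$, and these actions assemble to an action on $T$ by automorphisms. $\mathrm{IMG}(f)\subset\mathrm{Aut}(T)$ is the image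 of $\pi_1(\mathbb C\setminus P_c,t)$, i.e. its quotient by the kernel of the action. $\partial T$ is the space of infinite paths in $T$ starting at the root, with the topology from the product of the discrete level sets, and $\Phi$ is the induced action by homeomorphisms. Germinal groupoid of an action of a group $\Gamma$ on a space $\mathfrak X$: for $g\in\Gamma$, $y\in\mathfrak X$, the germ $[g]_y$ is the class of $g$ under $g_1\sim_y g_2$ iff $g_1\cdot y=g_2\cdot y$ and $g_1,g_2$ agree on an open neighborhood of $y$. $\mathcal G(\mathfrak X,\Gamma,\Phi)=\{[g]_y\mid g\in\Gamma,y\in\mathfrak X\}$ with the sheaf topology, with basis the sets $\{[g]_y\mid y\in U\}$, $g\in\Gamma$, $U\subset\mathfrak X$ open. *)

theory Defs
  imports
    "HOL-Analysis.Analysis"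
    "HOL-Computational_Algebra.Polynomial"
    "HOL-Algebra.Group_Action"
begin

section \<open>Post-critical orbits\<close>

definition post_critical_orbit :: "complex poly \<Rightarrow> complex \<Rightarrow> complex set" where
  "post_critical_orbit f c = {(poly f ^^ m) c | m. m \<ge> 1}"

definition strictly_preperiodic :: "complex poly \<Rightarrow> complex \<Rightarrow> bool" where
  "strictly_preperiodic f c \<longleftrightarrow>
     \<not> (\<exists>k\<ge>1. (poly f ^^ k) c = c) \<and>
     (\<exists>k\<ge>1. \<exists>m\<ge>1. \<forall>n\<ge>m. (poly f ^^ (n + k)) c = (poly f ^^ n) c)"

section \<open>The fundamental group\<close>

definition loops :: "complex set \<Rightarrow> complex \<Rightarrow> (real \<Rightarrow> complex) set" where
  "loops S t = {p. path p \<and> path_image p \<subseteq> S \<and> pathstart p = t \<and> pathfinish p = t}"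

definition loop_class :: "complex set \<Rightarrow> (real \<Rightarrow> complex) \<Rightarrow> (real \<Rightarrow> complex) set" where
  "loop_class S p = {q. homotopic_paths S p q}"

text \<open>In the product of the classes of \<open>p\<close> and \<open>q\<close> the loop \<open>q\<close> is traversed first, so
  that the monodromy action defined below is a left action.\<close>

definition fundamental_group :: "complex set \<Rightarrow> complex \<Rightarrow> (real \<Rightarrow> complex) set monoid" where
  "fundamental_group S t =
     \<lparr>carrier = loop_class S ` loops S t,
      mult = (\<lambda>A B. {r. \<exists>p\<in>A. \<exists>q\<in>B. homotopic_paths S (q +++ p) r}),
      one = loop_class S (linepath t t)\<rparr>"

section \<open>The tree of iterated preimages\<close>

text \<open>A vertex is a pair of a level and a point, since the sets \<open>level f t n\<close> for distinct
  \<open>n\<close> need not be disjoint as subsets of the plane.\<close>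

type_synonym vertex = "nat \<times> complex"

definition level :: "complex poly \<Rightarrow> complex \<Rightarrow> nat \<Rightarrow> complex set" where
  "level f t n = {z. (poly f ^^ n) z = t}"

definition tree_vertices :: "complex poly \<Rightarrow> complex \<Rightarrow> vertex set" where
  "tree_vertices f t = (SIGMA n:UNIV. level f t n)"

definition tree_edges :: "complex poly \<Rightarrow> complex \<Rightarrow> (vertex \<times> vertex) set" where
  "tree_edges f t = {((n, poly f z), (Suc n, z)) | n z. z \<in> level f t (Suc n)}"

definition tree_Aut :: "complex poly \<Rightarrow> complex \<Rightarrow> (vertex \<Rightarrow> vertex) monoid" where
  "tree_Aut f t = (BijGroup (tree_vertices f t))
     \<lparr>carrier := {g \<in> Bij (tree_vertices f t).
        g (0, t) = (0, t) \<and>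
        (\<forall>u\<in>tree_vertices f t. \<forall>v\<in>tree_vertices f t.
           (g u, g v) \<in> tree_edges f t \<longleftrightarrow> (u, v) \<in> tree_edges f t)}\<rparr>"

section \<open>The iterated monodromy group\<close>

text \<open>\<open>lifts_to f P n p z w\<close>: under the covering
  \<open>f\<^sup>n : \<complex> - f\<^sup>-\<^sup>n(P) \<rightarrow> \<complex> - P\<close>, the path \<open>p\<close> has a lift from \<open>z\<close> to \<open>w\<close>.\<close>

definition lifts_to ::
  "complex poly \<Rightarrow> complex set \<Rightarrow> nat \<Rightarrow> (real \<Rightarrow> complex) \<Rightarrow> complex \<Rightarrow> complex \<Rightarrow> bool" where
  "lifts_to f P n p z w \<longleftrightarrow>
     (\<exists>h. path h \<and> path_image h \<subseteq> - ((poly f ^^ n) -` P) \<and>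
          (\<forall>s\<in>{0..1}. (poly f ^^ n) (h s) = p s) \<and> pathstart h = z \<and> pathfinish h = w)"

text \<open>The monodromy action of a homotopy class \<open>A\<close> of loops; the endpoint \<open>w\<close> does not depend on
  the choice of \<open>p\<close> in \<open>A\<close>.\<close>

definition monodromy ::
  "complex poly \<Rightarrow> complex set \<Rightarrow> complex \<Rightarrow> (real \<Rightarrow> complex) set \<Rightarrow> vertex \<Rightarrow> vertex" where
  "monodromy f P t A =
     (\<lambda>(n, z)\<in>tree_vertices f t. (n, THE w. \<exists>p\<in>A. lifts_to f P n p z w))"

definition IMG :: "complex poly \<Rightarrow> complex set \<Rightarrow> complex \<Rightarrow> (vertex \<Rightarrow> vertex) monoid" where
  "IMG f P t = (tree_Aut f t)
     \<lparr>carrier := monodromy f P t ` carrier (fundamental_group (- P) t)\<rparr>"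

text \<open>An infinite path from the root is encoded by the sequence \<open>x\<close> whose \<open>n\<close>-th vertex is
  \<open>(n, x n)\<close>.\<close>

definition tree_boundary :: "complex poly \<Rightarrow> complex \<Rightarrow> (nat \<Rightarrow> complex) set" where
  "tree_boundary f t = {x. x 0 = t \<and> (\<forall>n. ((n, x n), (Suc n, x (Suc n))) \<in> tree_edges f t)}"

definition boundary_topology :: "complex poly \<Rightarrow> complex \<Rightarrow> (nat \<Rightarrow> complex) topology" where
  "boundary_topology f t =
     subtopology (product_topology (\<lambda>n. discrete_topology (level f t n)) UNIV) (tree_boundary f t)"

definition boundary_action ::
  "complex poly \<Rightarrow> complex \<Rightarrow> (vertex \<Rightarrow> vertex) \<Rightarrow> (nat \<Rightarrow> complex) \<Rightarrow> (nat \<Rightarrow> complex)" where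
  "boundary_action f t g = (\<lambda>x\<in>tree_boundary f t. \<lambda>n. snd (g (n, x n)))"

section \<open>Germinal groupoids\<close>

definition germ_equiv ::
  "'x topology \<Rightarrow> ('g \<Rightarrow> 'x \<Rightarrow> 'x) \<Rightarrow> 'x \<Rightarrow> 'g \<Rightarrow> 'g \<Rightarrow> bool" where
  "germ_equiv X \<phi> y g h \<longleftrightarrow>
     \<phi> g y = \<phi> h y \<and> (\<exists>U. openin X U \<and> y \<in> U \<and> (\<forall>x\<in>U. \<phi> g x = \<phi> h x))"

text \<open>The base point is recorded in the germ: as bare subsets of the group, equivalence classes at
  distinct points may coincide.\<close>

definition germ ::
  "('g, 'b) monoid_scheme \<Rightarrow> 'x topology \<Rightarrow> ('g \<Rightarrow> 'x \<Rightarrow> 'x) \<Rightarrow> 'g \<Rightarrow> 'x \<Rightarrow> 'x \<times> 'g set" where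
  "germ \<Gamma> X \<phi> g y = (y, {h \<in> carrier \<Gamma>. germ_equiv X \<phi> y g h})"

text \<open>The space of all germs with the sheaf topology. The generating family is closed under binary
  intersections, hence a basis and not only a subbasis.\<close>

definition germinal_groupoid ::
  "('g, 'b) monoid_scheme \<Rightarrow> 'x topology \<Rightarrow> ('g \<Rightarrow> 'x \<Rightarrow> 'x) \<Rightarrow> ('x \<times> 'g set) topology" where
  "germinal_groupoid \<Gamma> X \<phi> =
     topology_generated_by {germ \<Gamma> X \<phi> g ` U | g U. g \<in> carrier \<Gamma> \<and> openin X U}"

text \<open>The germinal groupoid of the action of \<open>IMG(f)\<close> on the boundary of the tree with root \<open>t\<close>,
  where \<open>c\<close> is the critical point of \<open>f\<close>.\<close>

definition IMG_groupoid ::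
  "complex poly \<Rightarrow> complex \<Rightarrow> complex \<Rightarrow> ((nat \<Rightarrow> complex) \<times> (vertex \<Rightarrow> vertex) set) topology" where
  "IMG_groupoid f c t =
     germinal_groupoid (IMG f (post_critical_orbit f c) t) (boundary_topology f t)
       (boundary_action f t)"

end

theory Submission
  imports Defs "HOL-Complex_Analysis.Complex_Analysis"
begin

text \<open>Two germs at a boundary point \<open>y\<close> are compared by a single loop \<open>p\<close> at \<open>t\<close> off the
  post-critical orbit \<open>P\<close>: they take the same value at \<open>y\<close> if and only if all lifts of \<open>p\<close> that start
  at the vertices of \<open>y\<close> are closed, and likewise at the points near \<open>y\<close>. The groupoid is Hausdorff
  if every such \<open>p\<close> fixes all points near \<open>y\<close>, or none except \<open>y\<close>
  (\<open>Hausdorff_IMG_groupoid\<close>). It is not Hausdorff if some \<open>p\<close> moves points arbitrarily close to \<open>y\<close>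
  and also fixes cones arbitrarily close to \<open>y\<close> (\<open>not_Hausdorff_IMG_groupoid\<close>). No generators of the
  fundamental group are needed.

  The Hausdorff cases rest on contraction: the lifts of a path under \<open>f\<^sup>n\<close> become uniformly short as
  \<open>n\<close> grows (\<open>lifts_shrink\<close>), because inverse branches form a normal family all of whose limits are
  constant (\<open>inverse_branches_shrink\<close>). A closed lift inside a disc without post-critical points has
  only closed lifts above it (\<open>trivial_on_cone\<close>), so only short lifts near \<open>P\<close> matter. If \<open>c\<close> is
  periodic, its cycle is superattracting and lifts stay away from it (\<open>Hausdorff_periodic\<close>). If \<open>P\<close>
  has two points, then they are \<open>v = f c\<close> and a fixed point \<open>w\<close>, and short lifts near \<open>P\<close> stay near \<open>w\<close>.
  Whether the loop fixes the points that branch off from \<open>y\<close> depends only on the parity of a winding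
  number around \<open>w\<close>, which is the same on all levels (\<open>Hausdorff_card_less_3\<close>).

  In the remaining case \<open>p\<close> runs around a periodic point \<open>\<rho>\<close> of \<open>P\<close>, and \<open>y\<close> follows its lifts
  around the cycle. Some backward orbit of \<open>\<rho>\<close> leads to \<open>v\<close>, and over it \<open>p\<close> has a lift that winds once
  around \<open>v\<close>, so that the next lift is not closed. Since \<open>P\<close> has at least three points, another
  backward orbit leaves \<open>P\<close> without passing through \<open>v\<close> (\<open>extra_preimage\<close>), and above it everything is
  fixed. Backward orbits may be extended by turns around the cycle first, so both phenomena occur
  arbitrarily close to \<open>y\<close> (\<open>not_Hausdorff_preperiodic\<close>).\<close>


section \<open>Separation of germs\<close>

lemma germ_eq_iff:
  assumes "g \<in> carrier \<Gamma>" "h \<in> carrier \<Gamma>"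
  shows "germ \<Gamma> X \<phi> g y = germ \<Gamma> X \<phi> h y \<longleftrightarrow>
           (\<exists>U. openin X U \<and> y \<in> U \<and> (\<forall>x\<in>U. \<phi> g x = \<phi> h x)) \<or> y \<notin> topspace X"
proof -
  have ge: "germ_equiv X \<phi> y k l \<longleftrightarrow> (\<exists>U. openin X U \<and> y \<in> U \<and> (\<forall>x\<in>U. \<phi> k x = \<phi> l x))" for k l
    unfolding germ_equiv_def by blast
  have trans: "germ_equiv X \<phi> y k m"
    if kl: "germ_equiv X \<phi> y k l" and lm: "germ_equiv X \<phi> y l m" for k l m
  proof -
    obtain U where U: "openin X U" "y \<in> U" "\<forall>x\<in>U. \<phi> k x = \<phi> l x"
      using kl unfolding ge by blast
    obtain V where V: "openin X V" "y \<in> V" "\<forall>x\<in>V. \<phi> l x = \<phi> m x"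
      using lm unfolding ge by blast
    show ?thesis
      unfolding ge using U V by (intro exI[of _ "U \<inter> V"]) auto
  qed
  have sym: "germ_equiv X \<phi> y l k" if kl: "germ_equiv X \<phi> y k l" for k l
  proof -
    obtain U where U: "openin X U" "y \<in> U" "\<forall>x\<in>U. \<phi> k x = \<phi> l x"
      using kl unfolding ge by blast
    show ?thesis
      unfolding ge using U by (intro exI[of _ U]) simp
  qed
  have refl: "y \<in> topspace X \<Longrightarrow> germ_equiv X \<phi> y k k" for k
    unfolding ge using openin_topspace by blast
  show ?thesis
  proof (cases "y \<in> topspace X")
    case True
    have "germ \<Gamma> X \<phi> g y = germ \<Gamma> X \<phi> h y \<longleftrightarrow> germ_equiv X \<phi> y g h"
    proof
      assume "germ \<Gamma> X \<phi> g y = germ \<Gamma> X \<phi> h y"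
      then have "{k \<in> carrier \<Gamma>. germ_equiv X \<phi> y g k} = {k \<in> carrier \<Gamma>. germ_equiv X \<phi> y h k}"
        by (simp add: germ_def)
      moreover have "h \<in> {k \<in> carrier \<Gamma>. germ_equiv X \<phi> y h k}"
        using assms refl[OF True] by simp
      ultimately show "germ_equiv X \<phi> y g h" by blast
    next
      assume "germ_equiv X \<phi> y g h"
      then have "germ_equiv X \<phi> y g k \<longleftrightarrow> germ_equiv X \<phi> y h k" for k
        using sym[of g h] trans[of g h k] trans[of h g k] by iprover
      then show "germ \<Gamma> X \<phi> g y = germ \<Gamma> X \<phi> h y"
        unfolding germ_def by simp
    qed
    also have "\<dots> \<longleftrightarrow> (\<exists>U. openin X U \<and> y \<in> U \<and> (\<forall>x\<in>U. \<phi> g x = \<phi> h x)) \<or> y \<notin> topspace X"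
      unfolding ge using True by iprover
    finally show ?thesis .
  next
    case False
    then have "\<not> germ_equiv X \<phi> y k l" for k l
      unfolding ge by (meson in_mono openin_subset)
    with False show ?thesis unfolding germ_def by simp
  qed
qed

lemma openin_germinal_groupoid:
  assumes "g \<in> carrier \<Gamma>" "openin X U"
  shows "openin (germinal_groupoid \<Gamma> X \<phi>) (germ \<Gamma> X \<phi> g ` U)"
  unfolding germinal_groupoid_def using assms
  by (intro topology_generated_by_Basis) blast

lemma topspace_germinal_groupoid:
  "topspace (germinal_groupoid \<Gamma> X \<phi>) =
     (\<Union>g\<in>carrier \<Gamma>. germ \<Gamma> X \<phi> g ` topspace X)"
proof
  show "topspace (germinal_groupoid \<Gamma> X \<phi>) \<subseteq> (\<Union>g\<in>carrier \<Gamma>. germ \<Gamma> X \<phi> g ` topspace X)"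
    unfolding germinal_groupoid_def topology_generated_by_topspace
    by (clarsimp simp: image_iff) (blast dest: openin_subset)
  show "(\<Union>g\<in>carrier \<Gamma>. germ \<Gamma> X \<phi> g ` topspace X) \<subseteq> topspace (germinal_groupoid \<Gamma> X \<phi>)"
    by (intro UN_least openin_subset openin_germinal_groupoid openin_topspace)
qed

lemma germ_neighbourhood:
  assumes "openin (germinal_groupoid \<Gamma> X \<phi>) W" "g \<in> carrier \<Gamma>" "y \<in> topspace X"
    and "germ \<Gamma> X \<phi> g y \<in> W"
  shows "\<exists>U. openin X U \<and> y \<in> U \<and> germ \<Gamma> X \<phi> g ` U \<subseteq> W"
proof -
  have "generate_topology_on {germ \<Gamma> X \<phi> g ` U | g U. g \<in> carrier \<Gamma> \<and> openin X U} W"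
    using assms(1) unfolding germinal_groupoid_def by (rule openin_topology_generated_by)
  then show ?thesis
    using assms(4)
  proof induction
    case Empty
    then show ?case by simp
  next
    case (Int V W)
    then obtain U U' where "openin X U" "y \<in> U" "germ \<Gamma> X \<phi> g ` U \<subseteq> V"
      "openin X U'" "y \<in> U'" "germ \<Gamma> X \<phi> g ` U' \<subseteq> W"
      by (metis IntD1 IntD2)
    then show ?case by (intro exI[of _ "U \<inter> U'"] conjI openin_Int IntI) blast+
  next
    case (UN \<K>)
    then obtain k where k: "k \<in> \<K>" "germ \<Gamma> X \<phi> g y \<in> k" by (rule_tac UnionE)
    then obtain U where "openin X U \<and> y \<in> U \<and> germ \<Gamma> X \<phi> g ` U \<subseteq> k"
      using UN.IH by iprover
    moreover have "k \<subseteq> \<Union>\<K>" using k(1) by (rule Union_upper)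
    ultimately show ?case by (metis subset_trans)
  next
    case (Basis V)
    then obtain h U where h: "h \<in> carrier \<Gamma>" "openin X U" "V = germ \<Gamma> X \<phi> h ` U"
      by blast
    then obtain x where x: "x \<in> U" "germ \<Gamma> X \<phi> g y = germ \<Gamma> X \<phi> h x"
      using Basis by blast
    then have xy: "x = y" by (simp add: germ_def)
    obtain U' where U': "openin X U'" "y \<in> U'" "\<forall>x\<in>U'. \<phi> g x = \<phi> h x"
      using x(2) assms(3) unfolding xy germ_eq_iff[OF assms(2) h(1)] by iprover
    have "germ \<Gamma> X \<phi> g z = germ \<Gamma> X \<phi> h z" if "z \<in> U \<inter> U'" for z
      unfolding germ_eq_iff[OF assms(2) h(1)] using U' that by blast
    then have "germ \<Gamma> X \<phi> g ` (U \<inter> U') \<subseteq> V"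
      unfolding h(3) by auto
    moreover have "openin X (U \<inter> U')" "y \<in> U \<inter> U'"
      using h(2) U'(1,2) x(1) xy by (simp_all add: openin_Int)
    ultimately show ?case by blast
  qed
qed

text \<open>Two germs at the same point are separated when their representatives disagree at all
  points nearby, because a common germ would force agreement.\<close>

lemma Hausdorff_germinal_groupoid:
  assumes "Hausdorff_space X"
    and alt: "\<And>g h y. \<lbrakk>g \<in> carrier \<Gamma>; h \<in> carrier \<Gamma>; y \<in> topspace X\<rbrakk> \<Longrightarrow>
      \<exists>U. openin X U \<and> y \<in> U \<and> ((\<forall>x\<in>U. \<phi> g x = \<phi> h x) \<or> (\<forall>x\<in>U. x \<noteq> y \<longrightarrow> \<phi> g x \<noteq> \<phi> h x))"
  shows "Hausdorff_space (germinal_groupoid \<Gamma> X \<phi>)"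
  unfolding Hausdorff_space_def
proof (intro allI impI)
  fix p q
  assume pq: "p \<in> topspace (germinal_groupoid \<Gamma> X \<phi>) \<and> q \<in> topspace (germinal_groupoid \<Gamma> X \<phi>) \<and> p \<noteq> q"
  obtain g y where g: "g \<in> carrier \<Gamma>" "y \<in> topspace X" "p = germ \<Gamma> X \<phi> g y"
    using pq unfolding topspace_germinal_groupoid by blast
  obtain h z where h: "h \<in> carrier \<Gamma>" "z \<in> topspace X" "q = germ \<Gamma> X \<phi> h z"
    using pq unfolding topspace_germinal_groupoid by blast
  have "\<exists>U V. openin X U \<and> openin X V \<and> y \<in> U \<and> z \<in> V \<and>
          disjnt (germ \<Gamma> X \<phi> g ` U) (germ \<Gamma> X \<phi> h ` V)"
  proof (cases "y = z")
    case False
    then obtain U V where UV: "openin X U" "openin X V" "y \<in> U" "z \<in> V" "disjnt U V"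
      using \<open>Hausdorff_space X\<close> g h unfolding Hausdorff_space_def by meson
    have "disjnt (germ \<Gamma> X \<phi> g ` U) (germ \<Gamma> X \<phi> h ` V)"
      using UV(5) by (auto simp: disjnt_def germ_def)
    then show ?thesis using UV by blast
  next
    case True
    obtain U where U: "openin X U" "y \<in> U"
      "(\<forall>x\<in>U. \<phi> g x = \<phi> h x) \<or> (\<forall>x\<in>U. x \<noteq> y \<longrightarrow> \<phi> g x \<noteq> \<phi> h x)"
      using alt[OF g(1) h(1) g(2)] by blast
    have ne: "germ \<Gamma> X \<phi> g y \<noteq> germ \<Gamma> X \<phi> h y"
      using pq g h True by simp
    then have "\<not> (\<forall>x\<in>U. \<phi> g x = \<phi> h x)"
      using U(1,2) unfolding germ_eq_iff[OF g(1) h(1)] by blast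
    then have U3: "\<forall>x\<in>U. x \<noteq> y \<longrightarrow> \<phi> g x \<noteq> \<phi> h x"
      using U(3) by blast
    have "germ \<Gamma> X \<phi> g x \<noteq> germ \<Gamma> X \<phi> h x" if "x \<in> U" for x
    proof (cases "x = y")
      case False
      have "x \<in> topspace X" using that U(1) openin_subset by blast
      with False show ?thesis
        using U3 that unfolding germ_eq_iff[OF g(1) h(1)] by blast
    qed (use ne in simp)
    then have "disjnt (germ \<Gamma> X \<phi> g ` U) (germ \<Gamma> X \<phi> h ` U)"
      unfolding disjnt_def by (auto simp: germ_def)
    then show ?thesis using U True by blast
  qed
  then obtain U V where UV: "openin X U" "openin X V" "y \<in> U" "z \<in> V"
      "disjnt (germ \<Gamma> X \<phi> g ` U) (germ \<Gamma> X \<phi> h ` V)"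
    by blast
  show "\<exists>U V. openin (germinal_groupoid \<Gamma> X \<phi>) U \<and> openin (germinal_groupoid \<Gamma> X \<phi>) V \<and>
      p \<in> U \<and> q \<in> V \<and> disjnt U V"
  proof (intro exI conjI)
    show "openin (germinal_groupoid \<Gamma> X \<phi>) (germ \<Gamma> X \<phi> g ` U)"
      by (rule openin_germinal_groupoid[OF g(1) UV(1)])
    show "openin (germinal_groupoid \<Gamma> X \<phi>) (germ \<Gamma> X \<phi> h ` V)"
      by (rule openin_germinal_groupoid[OF h(1) UV(2)])
  qed (use UV g(3) h(3) in auto)
qed

text \<open>Distinct germs at \<open>y\<close> that have a common germ in every neighbourhood of \<open>y\<close> cannot be
  separated.\<close>

lemma not_Hausdorff_germinal_groupoid:
  assumes g: "g \<in> carrier \<Gamma>" and h: "h \<in> carrier \<Gamma>" and y: "y \<in> topspace X"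
    and ne: "\<And>U. \<lbrakk>openin X U; y \<in> U\<rbrakk> \<Longrightarrow> \<exists>x\<in>U. \<phi> g x \<noteq> \<phi> h x"
    and eq: "\<And>U. \<lbrakk>openin X U; y \<in> U\<rbrakk> \<Longrightarrow>
      \<exists>V. openin X V \<and> V \<noteq> {} \<and> V \<subseteq> U \<and> (\<forall>x\<in>V. \<phi> g x = \<phi> h x)"
  shows "\<not> Hausdorff_space (germinal_groupoid \<Gamma> X \<phi>)"
proof
  assume H: "Hausdorff_space (germinal_groupoid \<Gamma> X \<phi>)"
  have "germ \<Gamma> X \<phi> g y \<noteq> germ \<Gamma> X \<phi> h y"
    unfolding germ_eq_iff[OF g h] using ne y by blast
  moreover have "germ \<Gamma> X \<phi> g y \<in> topspace (germinal_groupoid \<Gamma> X \<phi>)"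
    "germ \<Gamma> X \<phi> h y \<in> topspace (germinal_groupoid \<Gamma> X \<phi>)"
    using g h y by (auto simp: topspace_germinal_groupoid)
  ultimately obtain W W' where W: "openin (germinal_groupoid \<Gamma> X \<phi>) W"
      "openin (germinal_groupoid \<Gamma> X \<phi>) W'" "germ \<Gamma> X \<phi> g y \<in> W" "germ \<Gamma> X \<phi> h y \<in> W'" "disjnt W W'"
    using H unfolding Hausdorff_space_def by meson
  obtain U where U: "openin X U" "y \<in> U" "germ \<Gamma> X \<phi> g ` U \<subseteq> W"
    using germ_neighbourhood[OF W(1) g y W(3)] by blast
  obtain U' where U': "openin X U'" "y \<in> U'" "germ \<Gamma> X \<phi> h ` U' \<subseteq> W'"
    using germ_neighbourhood[OF W(2) h y W(4)] by blast
  obtain V where V: "openin X V" "V \<noteq> {}" "V \<subseteq> U \<inter> U'" "\<forall>x\<in>V. \<phi> g x = \<phi> h x"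
    using eq[of "U \<inter> U'"] U U' by blast
  then obtain x where "x \<in> V" by blast
  then have "germ \<Gamma> X \<phi> g x = germ \<Gamma> X \<phi> h x"
    unfolding germ_eq_iff[OF g h] using V by blast
  moreover have "germ \<Gamma> X \<phi> g x \<in> W" "germ \<Gamma> X \<phi> h x \<in> W'"
    using \<open>x \<in> V\<close> V(3) U(3) U'(3) by (auto simp: image_subset_iff)
  ultimately show False
    using W(5) unfolding disjnt_iff by metis
qed


section \<open>Lifting through the iterates of a quadratic polynomial\<close>

text \<open>A post-critically finite quadratic polynomial with its critical point, in the vertex form
  \<open>a * (z - c)\<^sup>2 + v\<close>, where \<open>v\<close> is the critical value.\<close>

locale quadratic_pcf =
  fixes f :: "complex poly" and c :: complex
  assumes deg: "degree f = 2"
    and crit: "poly (pderiv f) c = 0"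
    and fin: "finite (post_critical_orbit f c)"
begin

abbreviation P :: "complex set" where
  "P \<equiv> post_critical_orbit f c"

text \<open>The leading coefficient.\<close>

definition a :: complex where
  "a = coeff f 2"

abbreviation v :: complex where
  "v \<equiv> poly f c"

abbreviation F :: "nat \<Rightarrow> complex \<Rightarrow> complex" where
  "F n \<equiv> poly f ^^ n"

lemma a_nonzero: "a \<noteq> 0"
  by (metis a_def deg degree_0 leading_coeff_0_iff zero_neq_numeral)

lemma poly_vertex_form: "poly f z = a * (z - c)\<^sup>2 + v"
proof -
  obtain p q r where f: "f = [:p, q, r:]"
  proof -
    have "f = [:coeff f 0, coeff f 1, coeff f 2:]"
    proof (rule poly_eqI)
      fix n
      show "coeff f n = coeff [:coeff f 0, coeff f 1, coeff f 2:] n"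
        using deg by (cases n; cases "n - 1"; cases "n - 2")
          (auto simp: coeff_pCons numeral_2_eq_2 coeff_eq_0 split: nat.splits)
    qed
    then show ?thesis using that by blast
  qed
  have "coeff f 2 = r" by (simp add: f numeral_2_eq_2)
  then have ar: "a = r" by (simp add: a_def)
  have "q = - (2 * r * c)"
    using crit by (simp add: f pderiv_pCons algebra_simps eq_neg_iff_add_eq_0)
  then show ?thesis unfolding ar by (simp add: f power2_eq_square algebra_simps)
qed

lemma poly_eq_iff_pm: "poly f z = poly f w \<longleftrightarrow> z = w \<or> z = 2 * c - w"
proof -
  have "poly f z = poly f w \<longleftrightarrow> (z - c)\<^sup>2 = (w - c)\<^sup>2"
    using a_nonzero by (simp add: poly_vertex_form[of z] poly_vertex_form[of w])
  also have "\<dots> \<longleftrightarrow> z - c = w - c \<or> z - c = - (w - c)"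
    by (rule power2_eq_iff)
  also have "z - c = - (w - c) \<longleftrightarrow> z = 2 * c - w"
    by (auto simp: algebra_simps)
  also have "z - c = w - c \<longleftrightarrow> z = w"
    by simp
  finally show ?thesis .
qed

lemma poly_eq_v_iff: "poly f z = v \<longleftrightarrow> z = c"
  by (simp add: poly_vertex_form[of z] a_nonzero)

lemma poly_reflect: "poly f (2 * c - z) = poly f z"
  by (rule poly_eq_iff_pm[THEN iffD2]) (rule disjI2[OF refl])

lemma surj_poly: "\<exists>z. poly f z = w"
proof -
  have "poly f (csqrt ((w - v) / a) + c) = w"
    using a_nonzero by (simp add: poly_vertex_form[of "_ + c"])
  then show ?thesis by blast
qed

lemma F_Suc: "F (Suc n) z = F n (poly f z)"
  by (simp add: funpow_swap1)

lemma F_add: "F (m + n) z = F m (F n z)"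
  by (simp add: funpow_add)

lemma F_holomorphic: "F n holomorphic_on S"
proof (induction n arbitrary: S)
  case 0
  show ?case by (simp add: holomorphic_on_ident id_def)
next
  case (Suc n)
  have "poly f \<circ> F n holomorphic_on S"
    by (rule holomorphic_on_compose[OF Suc]) (simp add: holomorphic_intros)
  then show ?case unfolding funpow.simps .
qed

lemma F_continuous: "continuous_on S (F n)"
  using F_holomorphic holomorphic_on_imp_continuous_on by blast

lemma F_v: "F n v = F (Suc n) c"
  by (rule F_Suc[symmetric])

lemma F_v_in_P: "F n v \<in> P"
  unfolding F_v post_critical_orbit_def by (auto intro!: exI[of _ "Suc n"])

lemma in_P_iff: "z \<in> P \<longleftrightarrow> (\<exists>n. z = F n v)"
proof
  assume "z \<in> P"
  then obtain m where "z = F m c" "m \<ge> 1" unfolding post_critical_orbit_def by auto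
  then show "\<exists>n. z = F n v"
    unfolding F_v by (intro exI[of _ "m - 1"]) auto
qed (use F_v_in_P in blast)

lemma v_in_P: "v \<in> P"
  using F_v_in_P[of 0] by simp

lemma F_in_P: "z \<in> P \<Longrightarrow> F n z \<in> P"
  unfolding in_P_iff by (metis F_add)

lemma notin_P_pullback: "F n z \<notin> P \<Longrightarrow> z \<notin> P"
  using F_in_P by blast

text \<open>Every stage of the lift is a square root, which exists unless the previous stage meets the
  critical value. Away from \<open>b\<close> that cannot happen because \<open>G\<close> avoids \<open>P\<close>; at \<open>b\<close> itself,
  where \<open>G\<close> may take a value in \<open>P\<close>, it has to be required.\<close>

lemma holomorphic_lift:
  assumes S: "open S" "simply_connected S" and G: "G holomorphic_on S"
    and notP: "\<And>z. z \<in> S \<Longrightarrow> z \<noteq> b \<Longrightarrow> G z \<notin> P"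
    and b: "b \<in> S" "F m w = G b"
    and w: "\<And>i. 1 \<le> i \<Longrightarrow> i \<le> m \<Longrightarrow> F i w \<noteq> v"
  shows "\<exists>H. H holomorphic_on S \<and> (\<forall>z\<in>S. F m (H z) = G z) \<and> H b = w"
  using b w
proof (induction m arbitrary: w)
  case 0
  then show ?case using G by auto
next
  case (Suc m)
  have w': "F i (poly f w) \<noteq> v" if "1 \<le> i" "i \<le> m" for i
    using Suc.prems(3)[of "Suc i"] that unfolding F_Suc by simp
  have "F m (poly f w) = G b"
    using Suc.prems(2) unfolding F_Suc .
  then obtain H where H: "H holomorphic_on S" "\<And>z. z \<in> S \<Longrightarrow> F m (H z) = G z" "H b = poly f w"
    using Suc.IH[OF b(1) _ w'] by blast
  have Hv: "H z \<noteq> v" if "z \<in> S" for z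
  proof (cases "z = b")
    case True
    then show ?thesis using H Suc.prems(3)[of 1] by simp
  next
    case False
    then show ?thesis using notP[OF that False] H(2)[OF that] F_v_in_P by metis
  qed
  have "(\<lambda>z. (H z - v) / a) holomorphic_on S"
    by (intro holomorphic_intros H) (use a_nonzero in auto)
  moreover have "(H z - v) / a \<noteq> 0" if "z \<in> S" for z
    using Hv[OF that] a_nonzero by simp
  ultimately obtain g where g: "g holomorphic_on S" "\<And>z. z \<in> S \<Longrightarrow> (H z - v) / a = (g z)\<^sup>2"
    using simply_connected_imp_holomorphic_sqrt[of "\<lambda>z. (H z - v) / a" S] S(2)
      open_imp_locally_path_connected[OF S(1)] by blast
  have "(w - c)\<^sup>2 = (g b)\<^sup>2"
    using g(2)[OF b(1)] H(3) a_nonzero by (simp add: poly_vertex_form[of w])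
  then consider "w - c = g b" | "w - c = - g b"
    by (auto simp: power2_eq_iff)
  then obtain e where e: "e\<^sup>2 = 1" "w - c = e * g b"
  proof cases
    case 1
    then show ?thesis using that[of 1] by simp
  next
    case 2
    then show ?thesis using that[of "-1"] by simp
  qed
  define K where "K = (\<lambda>z. e * g z + c)"
  have K: "poly f (K z) = H z" if "z \<in> S" for z
  proof -
    have "poly f (K z) = a * (e\<^sup>2 * (g z)\<^sup>2) + v"
      by (simp add: K_def poly_vertex_form[of "_ + c"] power_mult_distrib)
    also have "\<dots> = H z"
      using a_nonzero by (simp add: e(1) flip: g(2)[OF that])
    finally show ?thesis .
  qed
  have "K holomorphic_on S" unfolding K_def by (intro holomorphic_intros g)
  moreover have "\<forall>z\<in>S. F (Suc m) (K z) = G z" unfolding F_Suc using K H(2) by simp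
  moreover have "K b = w" by (simp add: K_def flip: e(2))
  ultimately show ?case by blast
qed

text \<open>The case of an unconditional lift: \<open>G\<close> has all its values outside \<open>P\<close>.\<close>

lemma holomorphic_lift_avoiding:
  assumes S: "open S" "simply_connected S" and G: "G holomorphic_on S"
    and notP: "\<And>z. z \<in> S \<Longrightarrow> G z \<notin> P"
    and b: "b \<in> S" "F m w = G b"
  shows "\<exists>H. H holomorphic_on S \<and> (\<forall>z\<in>S. F m (H z) = G z) \<and> H b = w"
proof (rule holomorphic_lift[OF S G _ b])
  fix i assume i: "1 \<le> i" "i \<le> m"
  show "F i w \<noteq> v"
  proof
    assume "F i w = v"
    then have "G b = F (m - i) v"
      using b(2) F_add[of "m - i" i w] i by simp
    then show False using notP[OF b(1)] F_v_in_P by metis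
  qed
qed (use notP in blast)

text \<open>An inverse branch on \<open>S\<close> of the \<open>n\<close>-th iterate is a holomorphic section of it. The set \<open>S\<close> may
  contain points of the post-critical orbit.\<close>

definition inverse_branch :: "nat \<Rightarrow> complex set \<Rightarrow> (complex \<Rightarrow> complex) \<Rightarrow> bool" where
  "inverse_branch n S G \<longleftrightarrow> G holomorphic_on S \<and> (\<forall>z\<in>S. F n (G z) = z)"

lemma inverse_branch_exists:
  assumes "open S" "simply_connected S" "S \<inter> P = {}" "F n w \<in> S"
  shows "\<exists>G. inverse_branch n S G \<and> G (F n w) = w"
  using holomorphic_lift_avoiding[OF assms(1,2) holomorphic_on_ident _ assms(4), of n w] assms(3)
  unfolding inverse_branch_def by auto

lemma inverse_branch_inj: "inverse_branch n S G \<Longrightarrow> inj_on G S"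
  unfolding inverse_branch_def inj_on_def by metis

lemma inverse_branch_deriv_nonzero:
  assumes "inverse_branch n S G" "open S" "z \<in> S"
  shows "deriv (F n) (G z) \<noteq> 0" "deriv G z \<noteq> 0"
proof -
  have G: "G field_differentiable at z"
    using assms unfolding inverse_branch_def by (metis holomorphic_on_imp_differentiable_at)
  have Fn: "F n field_differentiable at (G z)"
    using F_holomorphic[of n UNIV] holomorphic_on_imp_differentiable_at by blast
  have "deriv (F n \<circ> G) z = deriv (F n) (G z) * deriv G z"
    by (rule deriv_chain[OF G Fn])
  moreover have "deriv (F n \<circ> G) z = deriv (\<lambda>z. z) z"
    by (rule complex_derivative_transform_within_open[OF _ _ assms(2,3)])
      (use assms in \<open>auto simp: inverse_branch_def F_holomorphic
        intro!: holomorphic_on_compose holomorphic_on_ident\<close>)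
  ultimately have "deriv (F n) (G z) * deriv G z = 1" by simp
  then show "deriv (F n) (G z) \<noteq> 0" "deriv G z \<noteq> 0" by auto
qed

lemma inverse_branch_unique:
  assumes G: "inverse_branch n S G" and H: "inverse_branch n S H"
    and S: "open S" "connected S" and b: "b \<in> S" "G b = H b" and z: "z \<in> S"
  shows "G z = H z"
proof -
  have hol: "G holomorphic_on S" "H holomorphic_on S"
    using G H unfolding inverse_branch_def by auto
  obtain r where r: "r > 0" "inj_on (F n) (ball (G b) r)"
    using has_complex_derivative_locally_injective[OF F_holomorphic[of n UNIV] UNIV_I open_UNIV
        inverse_branch_deriv_nonzero(1)[OF G S(1) b(1)]] by blast
  have op: "open (S \<inter> G -` ball (G b) r)" "open (S \<inter> H -` ball (G b) r)"
    using hol S(1) by (auto intro!: continuous_open_preimage holomorphic_on_imp_continuous_on)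
  define T where "T = (S \<inter> G -` ball (G b) r) \<inter> (S \<inter> H -` ball (G b) r)"
  have T: "open T" "b \<in> T" "T \<subseteq> S"
    using op b r unfolding T_def by auto
  have eqT: "G x = H x" if "x \<in> T" for x
  proof (rule inj_onD[OF r(2)])
    have "x \<in> S" using that T(3) by blast
    then show "F n (G x) = F n (H x)" using G H unfolding inverse_branch_def by metis
    show "G x \<in> ball (G b) r" "H x \<in> ball (G b) r" using that unfolding T_def by auto
  qed
  show ?thesis
    using T(2) by (intro analytic_continuation_open[OF T(1) S(1) _ S(2) T(3) hol eqT z]) blast+
qed

text \<open>The iterate \<open>F n\<close> is a covering of the complement of the post-critical orbit: over a disc
  that misses \<open>P\<close> the sheets are the images of the inverse branches.\<close>

lemma covering_space_F: "covering_space (- (F n -` P)) (F n) (- P)"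
proof
  show "continuous_on (- (F n -` P)) (F n)" by (rule F_continuous)
  have "\<exists>z. F n z = w" for w
  proof (induction n arbitrary: w)
    case (Suc n)
    then show ?case using surj_poly by (metis F_Suc)
  qed simp
  then have "w \<in> F n ` (- (F n -` P))" if "w \<in> - P" for w
    using that by (metis ComplD ComplI image_eqI vimage_eq)
  then show "F n ` (- (F n -` P)) = - P"
    by blast
next
  fix x assume x: "x \<in> - P"
  have "open (- P)" using fin by (simp add: finite_imp_closed open_Compl)
  then obtain r where r: "r > 0" "ball x r \<subseteq> - P"
    using x open_contains_ball by blast
  define T where "T = ball x r"
  have T: "open T" "simply_connected T" "connected T" "T \<inter> P = {}" "T \<subseteq> - P"
    using r unfolding T_def by (auto simp: convex_imp_simply_connected)
  define V where "V = {G ` T | G. inverse_branch n T G}"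
  have op: "open u" if "u \<in> V" for u
  proof -
    obtain G where G: "inverse_branch n T G" "u = G ` T"
      using \<open>u \<in> V\<close> unfolding V_def by blast
    have "continuous_on T G"
      using G(1) unfolding inverse_branch_def by (simp add: holomorphic_on_imp_continuous_on)
    then show ?thesis
      unfolding G(2) by (rule invariance_of_domain[OF _ T(1) inverse_branch_inj[OF G(1)]])
  qed
  have un: "\<Union>V = - (F n -` P) \<inter> F n -` T"
  proof
    show "\<Union>V \<subseteq> - (F n -` P) \<inter> F n -` T"
      using T unfolding V_def inverse_branch_def by auto
    show "- (F n -` P) \<inter> F n -` T \<subseteq> \<Union>V"
    proof
      fix w assume "w \<in> - (F n -` P) \<inter> F n -` T"
      then have w: "F n w \<in> T" by simp
      then obtain G where "inverse_branch n T G" "G (F n w) = w"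
        using inverse_branch_exists[OF T(1,2,4)] by blast
      then show "w \<in> \<Union>V" unfolding V_def using w by (metis (mono_tags, lifting) UnionI image_eqI mem_Collect_eq)
    qed
  qed
  have disj: "pairwise disjnt V"
  proof (rule pairwiseI)
    fix A B assume AB: "A \<in> V" "B \<in> V" "A \<noteq> B"
    obtain G where G: "inverse_branch n T G" "A = G ` T" using AB unfolding V_def by auto
    obtain H where H: "inverse_branch n T H" "B = H ` T" using AB unfolding V_def by auto
    show "disjnt A B"
    proof (rule ccontr)
      assume "\<not> disjnt A B"
      then obtain z w where zw: "z \<in> T" "w \<in> T" "G z = H w"
        unfolding disjnt_def G H by auto
      then have "z = w" using G(1) H(1) unfolding inverse_branch_def by metis
      then have "G x = H x" if "x \<in> T" for x
        using inverse_branch_unique[OF G(1) H(1) T(1,3) zw(1) _ that] zw by simp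
      then show False using AB(3) G(2) H(2) by auto
    qed
  qed
  have hom: "homeomorphism (G ` T) T (F n) G" if "inverse_branch n T G" for G
    using that unfolding inverse_branch_def homeomorphism_def
    by (auto simp: F_continuous holomorphic_on_imp_continuous_on image_iff)
  show "\<exists>T. x \<in> T \<and> openin (top_of_set (- P)) T \<and>
          (\<exists>v. \<Union>v = - (F n -` P) \<inter> F n -` T \<and> (\<forall>u\<in>v. openin (top_of_set (- (F n -` P))) u) \<and>
            pairwise disjnt v \<and> (\<forall>u\<in>v. \<exists>q. homeomorphism u T (F n) q))"
  proof (intro exI[of _ T] exI[of _ V] conjI ballI)
    show "x \<in> T" using r T_def by simp
    show "openin (top_of_set (- P)) T" using T by (simp add: open_subset)
    show "openin (top_of_set (- (F n -` P))) u" if "u \<in> V" for u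
      using op[OF that] un that by (intro open_subset) auto
    show "\<exists>q. homeomorphism u T (F n) q" if "u \<in> V" for u
      using that hom unfolding V_def by auto
  qed (use un disj in auto)
qed

end


section \<open>Monodromy in terms of lifted paths\<close>

lemma tree_boundary_iff:
  "x \<in> tree_boundary f t \<longleftrightarrow> x 0 = t \<and> (\<forall>n. poly f (x (Suc n)) = x n)"
proof -
  have edge: "((n, w), (Suc n, z)) \<in> tree_edges f t \<longleftrightarrow> poly f z = w \<and> z \<in> level f t (Suc n)"
    for n w z
    unfolding tree_edges_def by auto
  show ?thesis
  proof
    assume "x \<in> tree_boundary f t"
    then show "x 0 = t \<and> (\<forall>n. poly f (x (Suc n)) = x n)"
      unfolding tree_boundary_def edge by blast
  next
    assume x: "x 0 = t \<and> (\<forall>n. poly f (x (Suc n)) = x n)"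
    have "(poly f ^^ n) (x n) = t" for n
    proof (induction n)
      case (Suc n)
      then show ?case using x by (simp only: funpow_Suc_right o_apply)
    qed (use x in simp)
    then show "x \<in> tree_boundary f t"
      using x unfolding tree_boundary_def edge level_def by blast
  qed
qed

lemma tree_boundary_funpow:
  assumes "x \<in> tree_boundary f t"
  shows "(poly f ^^ m) (x (n + m)) = x n"
proof (induction m)
  case (Suc m)
  have "poly f (x (Suc (n + m))) = x (n + m)" using assms by (simp add: tree_boundary_iff)
  then show ?case using Suc by (simp only: funpow_Suc_right o_apply add_Suc_right)
qed simp

lemma tree_boundary_level:
  assumes "x \<in> tree_boundary f t"
  shows "x n \<in> level f t n"
  using tree_boundary_funpow[OF assms, of n 0] assms
  by (simp add: level_def tree_boundary_iff)

lemma topspace_boundary_topology: "topspace (boundary_topology f t) = tree_boundary f t"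
  unfolding boundary_topology_def using tree_boundary_level by (auto simp: PiE_iff)

lemma Hausdorff_boundary_topology: "Hausdorff_space (boundary_topology f t)"
  unfolding boundary_topology_def
  by (intro Hausdorff_space_subtopology) (simp add: Hausdorff_space_product_topology)

lemma openin_cone:
  "openin (boundary_topology f t) {x \<in> tree_boundary f t. x n = y}"
proof -
  have "openin (discrete_topology (level f t i)) (if i = n then {y} \<inter> level f t i else level f t i)" for i
    by simp
  moreover have "finite {i. (if i = n then {y} \<inter> level f t i else level f t i) \<noteq> topspace (discrete_topology (level f t i))}"
    by (rule finite_subset[of _ "{n}"]) auto
  ultimately have op: "openin (product_topology (\<lambda>n. discrete_topology (level f t n)) UNIV)
      (\<Pi>\<^sub>E i\<in>UNIV. if i = n then {y} \<inter> level f t i else level f t i)"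
    by (rule product_topology_basis)
  have eq: "{x \<in> tree_boundary f t. x n = y} =
      (\<Pi>\<^sub>E i\<in>UNIV. if i = n then {y} \<inter> level f t i else level f t i) \<inter> tree_boundary f t"
    using tree_boundary_level by (auto simp: PiE_iff split: if_splits)
  show ?thesis
    unfolding boundary_topology_def openin_subtopology eq using op by blast
qed

lemma cone_subset_open:
  assumes "openin (boundary_topology f t) U" "y \<in> U"
  shows "\<exists>n. {x \<in> tree_boundary f t. x n = y n} \<subseteq> U"
proof -
  obtain V where V: "openin (product_topology (\<lambda>n. discrete_topology (level f t n)) UNIV) V"
      "U = V \<inter> tree_boundary f t"
    using assms(1) unfolding boundary_topology_def openin_subtopology by blast
  have y: "y \<in> V" "y \<in> tree_boundary f t" using assms V by auto
  obtain X where X: "finite {i. X i \<noteq> level f t i}" "y \<in> Pi\<^sub>E UNIV X" "Pi\<^sub>E UNIV X \<subseteq> V"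
    using product_topology_open_contains_basis[OF V(1) y(1)] by (auto simp only: topspace_discrete_topology)
  obtain n where n: "\<And>i. X i \<noteq> level f t i \<Longrightarrow> i \<le> n"
    using X(1) unfolding finite_nat_set_iff_bounded_le by auto
  have "x \<in> U" if x: "x \<in> tree_boundary f t" "x n = y n" for x
  proof -
    have "x i \<in> X i" for i
    proof (cases "X i = level f t i")
      case True
      then show ?thesis using tree_boundary_level[OF x(1)] by simp
    next
      case False
      then obtain m where "n = i + m" using n le_Suc_ex by blast
      then have "x i = y i"
        using tree_boundary_funpow[OF x(1), of m i] tree_boundary_funpow[OF y(2), of m i] x(2) by simp
      then show ?thesis using X(2) by (auto simp: PiE_iff)
    qed
    then show ?thesis using X(3) V(2) x(1) by (auto simp: PiE_iff)
  qed
  then show ?thesis by blast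
qed

context quadratic_pcf
begin

text \<open>The path \<open>h\<close> lifts \<open>p\<close> under the \<open>n\<close>-th iterate. If \<open>p\<close> avoids the post-critical orbit, then \<open>h\<close>
  avoids its preimage, so that no such condition is included.\<close>

definition is_lift :: "nat \<Rightarrow> (real \<Rightarrow> complex) \<Rightarrow> (real \<Rightarrow> complex) \<Rightarrow> bool" where
  "is_lift n p h \<longleftrightarrow> path h \<and> (\<forall>s\<in>{0..1}. F n (h s) = p s)"

lemma lifts_to_iff:
  assumes "path_image p \<subseteq> - P"
  shows "lifts_to f P n p z w \<longleftrightarrow> (\<exists>h. is_lift n p h \<and> pathstart h = z \<and> pathfinish h = w)"
proof -
  have "path_image h \<subseteq> - (F n -` P)" if "is_lift n p h" for h
    using that assms unfolding is_lift_def path_image_def by auto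
  then show ?thesis unfolding lifts_to_def is_lift_def by blast
qed

lemma lift_unique_on:
  assumes "continuous_on T p" "p ` T \<subseteq> - P" "connected T"
    and h: "continuous_on T h" "\<And>s. s \<in> T \<Longrightarrow> F n (h s) = p s"
    and k: "continuous_on T k" "\<And>s. s \<in> T \<Longrightarrow> F n (k s) = p s"
    and b: "b \<in> T" "h b = k b" and s: "s \<in> T"
  shows "h s = k s"
proof (rule covering_space_lift_unique[OF covering_space_F[of n], of h b k T p])
  show "h \<in> T \<rightarrow> - (F n -` P)" using h(2) assms(2) by auto
  show "k \<in> T \<rightarrow> - (F n -` P)" using k(2) assms(2) by auto
qed (use assms in auto)

lemma is_lift_unique:
  assumes p: "path p" "path_image p \<subseteq> - P" and h: "is_lift n p h" "is_lift n p k"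
    and b: "b \<in> {0..1}" "h b = k b" and s: "s \<in> {0..1}"
  shows "h s = k s"
  using lift_unique_on[of "{0..1}" p h n k b s] assms
  unfolding is_lift_def path_def path_image_def by simp

lemma is_lift_exists:
  assumes p: "path p" "path_image p \<subseteq> - P" and z: "F n z = pathstart p"
  shows "\<exists>h. is_lift n p h \<and> pathstart h = z"
proof -
  have "pathstart p \<in> - P" using p by (meson pathstart_in_path_image subsetD)
  then have "z \<in> - (F n -` P)" using z by simp
  then show ?thesis
    using covering_space_lift_path_strong[OF covering_space_F _ p z[symmetric]] unfolding is_lift_def
    by metis
qed

lemma lifts_to_endpoints:
  assumes "lifts_to f P n p z w"
  shows "F n z = pathstart p" "F n w = pathfinish p"
proof -
  obtain h where h: "\<forall>s\<in>{0..1}. F n (h s) = p s" "pathstart h = z" "pathfinish h = w"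
    using assms unfolding lifts_to_def by blast
  show "F n z = pathstart p" "F n w = pathfinish p"
    using bspec[OF h(1), of 0] bspec[OF h(1), of 1] h(2,3) by (simp_all add: pathstart_def pathfinish_def)
qed

lemma lifts_to_unique:
  assumes "path p" "path_image p \<subseteq> - P" "lifts_to f P n p z w" "lifts_to f P n p z w'"
  shows "w = w'"
proof -
  obtain h k where hk: "is_lift n p h" "pathstart h = z" "pathfinish h = w"
      "is_lift n p k" "pathstart k = z" "pathfinish k = w'"
    using assms(3,4) unfolding lifts_to_iff[OF assms(2)] by blast
  have "h 0 = k 0" using hk(2,5) by (simp add: pathstart_def)
  then have "h 1 = k 1"
    using is_lift_unique[OF assms(1,2) hk(1,4), of 0 1] by simp
  then show ?thesis using hk by (simp add: pathfinish_def)
qed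

lemma lifts_to_exists:
  assumes "path p" "path_image p \<subseteq> - P" "F n z = pathstart p"
  shows "\<exists>w. lifts_to f P n p z w"
  using is_lift_exists[OF assms] unfolding lifts_to_iff[OF assms(2)] by blast

lemma is_lift_F:
  assumes "is_lift (m + n) p h"
  shows "is_lift m p (F n \<circ> h)"
proof -
  have "continuous_on {0..1} (F n \<circ> h)"
    using assms unfolding is_lift_def path_def by (intro continuous_on_compose F_continuous) simp
  then show ?thesis
    using assms unfolding is_lift_def path_def by (simp add: F_add)
qed

lemma lifts_to_F:
  assumes "path_image p \<subseteq> - P" "lifts_to f P (m + n) p z w"
  shows "lifts_to f P m p (F n z) (F n w)"
proof -
  obtain h where h: "is_lift (m + n) p h" "pathstart h = z" "pathfinish h = w"
    using assms(2) unfolding lifts_to_iff[OF assms(1)] by blast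
  show ?thesis
    unfolding lifts_to_iff[OF assms(1)]
    using is_lift_F[OF h(1)] h(2,3)
    by (intro exI[of _ "F n \<circ> h"]) (simp add: pathstart_compose pathfinish_compose)
qed

lemma lifts_to_join:
  assumes "path_image p \<subseteq> - P" "path_image q \<subseteq> - P"
    and "lifts_to f P n p z u" "lifts_to f P n q u w"
  shows "lifts_to f P n (p +++ q) z w"
proof -
  obtain h k where hk: "is_lift n p h" "pathstart h = z" "pathfinish h = u"
      "is_lift n q k" "pathstart k = u" "pathfinish k = w"
    using assms(3,4) unfolding lifts_to_iff[OF assms(1)] lifts_to_iff[OF assms(2)] by blast
  have "is_lift n (p +++ q) (h +++ k)"
    unfolding is_lift_def
  proof
    show "path (h +++ k)" using hk unfolding is_lift_def by (intro path_join_imp) simp_all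
    show "\<forall>s\<in>{0..1}. F n ((h +++ k) s) = (p +++ q) s"
      using hk(1,4) unfolding is_lift_def joinpaths_def by auto
  qed
  moreover have "path_image (p +++ q) \<subseteq> - P"
    using assms(1,2) path_image_join_subset by blast
  ultimately show ?thesis using hk by (auto simp: lifts_to_iff)
qed

lemma lifts_to_joinD:
  assumes p: "path p" "path_image p \<subseteq> - P" and q: "path q" "path_image q \<subseteq> - P"
    and pq: "pathfinish p = pathstart q" and l: "lifts_to f P n (p +++ q) z w"
  shows "\<exists>u. lifts_to f P n p z u \<and> lifts_to f P n q u w"
proof -
  obtain u where u: "lifts_to f P n p z u"
    using lifts_to_exists[OF p] lifts_to_endpoints(1)[OF l] by auto
  obtain w' where w': "lifts_to f P n q u w'"
    using lifts_to_exists[OF q] lifts_to_endpoints(2)[OF u] pq by auto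
  have "w' = w"
  proof (rule lifts_to_unique[OF _ _ lifts_to_join[OF p(2) q(2) u w'] l])
    show "path (p +++ q)" using p q pq by simp
    show "path_image (p +++ q) \<subseteq> - P" using p q path_image_join_subset by blast
  qed
  then show ?thesis using u w' by blast
qed

lemma lifts_to_reversepath:
  assumes "path_image p \<subseteq> - P"
  shows "lifts_to f P n (reversepath p) w z \<longleftrightarrow> lifts_to f P n p z w"
proof -
  have rev: "is_lift n (reversepath q) (reversepath h)" if "is_lift n q h" for q h
    using that unfolding is_lift_def by (auto simp: reversepath_def path_reversepath[unfolded reversepath_def])
  have *: "lifts_to f P n (reversepath q) w z" if lq: "lifts_to f P n q z w" and q: "path_image q \<subseteq> - P" for q w z
  proof -
    obtain h where h: "is_lift n q h" "pathstart h = z" "pathfinish h = w"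
      using lq unfolding lifts_to_iff[OF q] by blast
    have "path_image (reversepath q) \<subseteq> - P" using q by simp
    then show ?thesis
      using rev[OF h(1)] h(2,3)
      by (auto simp: lifts_to_iff intro!: exI[of _ "reversepath h"])
  qed
  show ?thesis
    using *[of p z w] *[of "reversepath p" w z] assms by auto
qed

lemma lifts_to_homotopic:
  assumes "homotopic_paths (- P) p q" "lifts_to f P n p z w"
  shows "lifts_to f P n q z w"
proof -
  have p: "path p" "path_image p \<subseteq> - P" and q: "path q" "path_image q \<subseteq> - P"
    using homotopic_paths_imp_path[OF assms(1)] homotopic_paths_imp_subset[OF assms(1)] by auto
  obtain w' where w': "lifts_to f P n q z w'"
    using lifts_to_exists[OF q] lifts_to_endpoints(1)[OF assms(2)]
      homotopic_paths_imp_pathstart[OF assms(1)] by auto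
  obtain h k where hk: "path h" "path_image h \<subseteq> - (F n -` P)" "\<forall>s\<in>{0..1}. F n (h s) = p s"
      "pathstart h = z" "pathfinish h = w"
      "path k" "path_image k \<subseteq> - (F n -` P)" "\<forall>s\<in>{0..1}. F n (k s) = q s"
      "pathstart k = z" "pathfinish k = w'"
    using assms(2) w' unfolding lifts_to_def by blast
  have "pathfinish h = pathfinish k"
    by (rule covering_space_monodromy[OF covering_space_F p q assms(1) hk(1,2) _ hk(6,7)]) (use hk in auto)
  then show ?thesis using w' hk by simp
qed

lemma loopsD:
  assumes "p \<in> loops S t"
  shows "path p" "path_image p \<subseteq> S" "pathstart p = t" "pathfinish p = t"
  using assms unfolding loops_def by auto

lemma monodromy_eq:
  assumes p: "p \<in> loops (- P) t" and l: "lifts_to f P n p z w"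
  shows "monodromy f P t (loop_class (- P) p) (n, z) = (n, w)"
proof -
  have "z \<in> level f t n"
    using lifts_to_endpoints(1)[OF l] loopsD[OF p] unfolding level_def by simp
  then have z: "(n, z) \<in> tree_vertices f t" unfolding tree_vertices_def by simp
  have "(THE w'. \<exists>q\<in>loop_class (- P) p. lifts_to f P n q z w') = w"
  proof (rule the_equality)
    have "homotopic_paths (- P) p p" using loopsD[OF p] by simp
    then show "\<exists>q\<in>loop_class (- P) p. lifts_to f P n q z w"
      using l unfolding loop_class_def by blast
  next
    fix w' assume "\<exists>q\<in>loop_class (- P) p. lifts_to f P n q z w'"
    then obtain q where "homotopic_paths (- P) p q" "lifts_to f P n q z w'"
      unfolding loop_class_def by blast
    then have "lifts_to f P n p z w'"
      using lifts_to_homotopic homotopic_paths_sym by blast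
    then show "w' = w"
      using lifts_to_unique[OF loopsD(1,2)[OF p]] l by blast
  qed
  then show ?thesis using z unfolding monodromy_def by simp
qed

lemma boundary_action_agree_iff:
  assumes p: "p \<in> loops (- P) t" and q: "q \<in> loops (- P) t" and x: "x \<in> tree_boundary f t"
  shows "boundary_action f t (monodromy f P t (loop_class (- P) p)) x =
         boundary_action f t (monodromy f P t (loop_class (- P) q)) x \<longleftrightarrow>
           (\<forall>n. lifts_to f P n (p +++ reversepath q) (x n) (x n))"
proof -
  have xn: "F n (x n) = t" for n
    using tree_boundary_level[OF x] unfolding level_def by simp
  note p' = loopsD[OF p] and q' = loopsD[OF q]
  have *: "snd (monodromy f P t (loop_class (- P) p) (n, x n)) = snd (monodromy f P t (loop_class (- P) q) (n, x n)) \<longleftrightarrow>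
        lifts_to f P n (p +++ reversepath q) (x n) (x n)" (is "?L \<longleftrightarrow> ?R") for n
  proof -
    obtain u where u: "lifts_to f P n p (x n) u"
      using lifts_to_exists[OF p'(1,2), of n "x n"] xn p'(3) by auto
    obtain w where w: "lifts_to f P n q (x n) w"
      using lifts_to_exists[OF q'(1,2), of n "x n"] xn q'(3) by auto
    have "?L \<longleftrightarrow> u = w"
      using monodromy_eq[OF p u] monodromy_eq[OF q w] by simp
    moreover have "?R" if "u = w"
      using that lifts_to_join[OF p'(2) _ u, of "reversepath q" "x n"] w
      by (simp add: lifts_to_reversepath[OF q'(2)] q'(2))
    moreover have "u = w" if R: ?R
    proof -
      obtain u' where u': "lifts_to f P n p (x n) u'" "lifts_to f P n (reversepath q) u' (x n)"
        using lifts_to_joinD[OF p'(1,2) _ _ _ R] p' q' by auto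
      then have "lifts_to f P n q (x n) u'" by (simp add: lifts_to_reversepath[OF q'(2)])
      then have "u' = w" using lifts_to_unique[OF q'(1,2)] w by blast
      moreover have "u' = u" using lifts_to_unique[OF p'(1,2)] u u'(1) by blast
      ultimately show ?thesis by simp
    qed
    ultimately show ?thesis by blast
  qed
  show ?thesis
    unfolding boundary_action_def restrict_apply'[OF x] fun_eq_iff * ..
qed

lemma carrier_IMG: "carrier (IMG f P t) = (\<lambda>p. monodromy f P t (loop_class (- P) p)) ` loops (- P) t"
  unfolding IMG_def fundamental_group_def by (simp add: image_image)

text \<open>The group structure of \<open>IMG f P t\<close> enters only through single loops: two loops agree at a
  boundary point if and only if all lifts of their quotient along that point are closed.\<close>

lemma Hausdorff_IMG_groupoid:
  assumes alt: "\<And>p y. \<lbrakk>p \<in> loops (- P) t; y \<in> tree_boundary f t; \<And>n. lifts_to f P n p (y n) (y n)\<rbrakk> \<Longrightarrow>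
     \<exists>N. (\<forall>x\<in>tree_boundary f t. x N = y N \<longrightarrow> (\<forall>n. lifts_to f P n p (x n) (x n))) \<or>
         (\<forall>x\<in>tree_boundary f t. x N = y N \<longrightarrow> x \<noteq> y \<longrightarrow> (\<exists>n. \<not> lifts_to f P n p (x n) (x n)))"
  shows "Hausdorff_space (IMG_groupoid f c t)"
  unfolding IMG_groupoid_def
proof (rule Hausdorff_germinal_groupoid[OF Hausdorff_boundary_topology])
  fix g h y
  assume g: "g \<in> carrier (IMG f P t)" and h: "h \<in> carrier (IMG f P t)"
    and "y \<in> topspace (boundary_topology f t)"
  then have y: "y \<in> tree_boundary f t" by (simp add: topspace_boundary_topology)
  obtain p where p: "p \<in> loops (- P) t" "g = monodromy f P t (loop_class (- P) p)"
    using g unfolding carrier_IMG by blast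
  obtain q where q: "q \<in> loops (- P) t" "h = monodromy f P t (loop_class (- P) q)"
    using h unfolding carrier_IMG by blast
  define r where "r = p +++ reversepath q"
  have r: "r \<in> loops (- P) t"
    using loopsD[OF p(1)] loopsD[OF q(1)] unfolding r_def loops_def
    by (auto simp: path_image_join)
  have agree: "boundary_action f t g x = boundary_action f t h x \<longleftrightarrow> (\<forall>n. lifts_to f P n r (x n) (x n))"
    if "x \<in> tree_boundary f t" for x
    unfolding p(2) q(2) r_def by (rule boundary_action_agree_iff[OF p(1) q(1) that])
  have "\<exists>N. (\<forall>x\<in>tree_boundary f t. x N = y N \<longrightarrow> boundary_action f t g x = boundary_action f t h x) \<or>
         (\<forall>x\<in>tree_boundary f t. x N = y N \<longrightarrow> x \<noteq> y \<longrightarrow> boundary_action f t g x \<noteq> boundary_action f t h x)"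
  proof (cases "\<forall>n. lifts_to f P n r (y n) (y n)")
    case True
    then show ?thesis using alt[OF r y] agree by simp
  next
    case False
    then obtain n where n: "\<not> lifts_to f P n r (y n) (y n)" by blast
    then show ?thesis
      using agree by (intro exI[of _ n] disjI2) metis
  qed
  then obtain N where N: "(\<forall>x\<in>tree_boundary f t. x N = y N \<longrightarrow> boundary_action f t g x = boundary_action f t h x) \<or>
         (\<forall>x\<in>tree_boundary f t. x N = y N \<longrightarrow> x \<noteq> y \<longrightarrow> boundary_action f t g x \<noteq> boundary_action f t h x)"
    by blast
  show "\<exists>U. openin (boundary_topology f t) U \<and> y \<in> U \<and>
      ((\<forall>x\<in>U. boundary_action f t g x = boundary_action f t h x) \<or>
       (\<forall>x\<in>U. x \<noteq> y \<longrightarrow> boundary_action f t g x \<noteq> boundary_action f t h x))"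
    using N y openin_cone[of f t N "y N"]
    by (intro exI[of _ "{x \<in> tree_boundary f t. x N = y N}"]) blast
qed

lemma not_Hausdorff_IMG_groupoid:
  assumes p: "p \<in> loops (- P) t" and y: "y \<in> tree_boundary f t"
    and ne: "\<And>N. \<exists>x\<in>tree_boundary f t. x N = y N \<and> (\<exists>n. \<not> lifts_to f P n p (x n) (x n))"
    and eq: "\<And>N. \<exists>M\<ge>N. \<exists>x\<in>tree_boundary f t. x N = y N \<and>
       (\<forall>x'\<in>tree_boundary f t. x' M = x M \<longrightarrow> (\<forall>n. lifts_to f P n p (x' n) (x' n)))"
  shows "\<not> Hausdorff_space (IMG_groupoid f c t)"
proof -
  note p' = loopsD[OF p]
  have t: "t \<notin> P" using p' pathstart_in_path_image[of p] by auto
  have l: "linepath t t \<in> loops (- P) t" using t by (simp add: loops_def)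
  have hom: "homotopic_paths (- P) (p +++ reversepath (linepath t t)) p"
    using homotopic_paths_rid[OF p'(1,2)] p'(4) by simp
  define g where "g = monodromy f P t (loop_class (- P) p)"
  define h where "h = monodromy f P t (loop_class (- P) (linepath t t))"
  have agree: "boundary_action f t g x = boundary_action f t h x \<longleftrightarrow> (\<forall>n. lifts_to f P n p (x n) (x n))"
    if "x \<in> tree_boundary f t" for x
    unfolding g_def h_def boundary_action_agree_iff[OF p l that]
    using lifts_to_homotopic[OF hom] lifts_to_homotopic[OF homotopic_paths_sym[OF hom]] by blast
  show ?thesis
    unfolding IMG_groupoid_def
  proof (rule not_Hausdorff_germinal_groupoid[where g = g and h = h and y = y])
    show "g \<in> carrier (IMG f P t)" "h \<in> carrier (IMG f P t)"
      unfolding carrier_IMG g_def h_def using p l by blast+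
    show "y \<in> topspace (boundary_topology f t)"
      using y by (simp add: topspace_boundary_topology)
  next
    fix U assume "openin (boundary_topology f t) U" "y \<in> U"
    then obtain N where N: "{x \<in> tree_boundary f t. x N = y N} \<subseteq> U"
      using cone_subset_open by blast
    obtain x where "x \<in> tree_boundary f t" "x N = y N" "\<exists>n. \<not> lifts_to f P n p (x n) (x n)"
      using ne[of N] by blast
    then show "\<exists>x\<in>U. boundary_action f t g x \<noteq> boundary_action f t h x"
      using agree[of x] N by blast
    obtain M x where M: "M \<ge> N" "x \<in> tree_boundary f t" "x N = y N"
       "\<forall>x'\<in>tree_boundary f t. x' M = x M \<longrightarrow> (\<forall>n. lifts_to f P n p (x' n) (x' n))"
      using eq[of N] by blast
    define V where "V = {x' \<in> tree_boundary f t. x' M = x M}"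
    have "x' N = y N" if "x' \<in> V" for x'
    proof -
      obtain k where "M = N + k" using M(1) le_Suc_ex by blast
      then show ?thesis
        using that tree_boundary_funpow[of x' f t k N] tree_boundary_funpow[OF M(2), of k N] M(3)
        unfolding V_def by simp
    qed
    then have "V \<subseteq> U" using N unfolding V_def by blast
    moreover have "openin (boundary_topology f t) V" unfolding V_def by (rule openin_cone)
    moreover have "x \<in> V" using M(2) unfolding V_def by simp
    moreover have "\<forall>x\<in>V. boundary_action f t g x = boundary_action f t h x"
      using M(4) agree unfolding V_def by simp
    ultimately show "\<exists>V. openin (boundary_topology f t) V \<and> V \<noteq> {} \<and> V \<subseteq> U \<and>
        (\<forall>x\<in>V. boundary_action f t g x = boundary_action f t h x)"
      by blast
  qed
qed

lemma vertex_extends: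
  assumes "F n z = t"
  shows "\<exists>x\<in>tree_boundary f t. x n = z"
proof -
  obtain s where s: "\<And>w. poly f (s w) = w" using surj_poly by metis
  have Fs: "F m ((s ^^ m) w) = w" for m w
    by (induction m arbitrary: w) (simp_all add: funpow_swap1 s)
  define x where "x = (\<lambda>m. if m \<le> n then F (n - m) z else (s ^^ (m - n)) z)"
  have "poly f (x (Suc m)) = x m" for m
  proof (cases "m < n")
    case True
    then have "n - m = Suc (n - Suc m)" by simp
    then show ?thesis using True by (simp add: x_def)
  next
    case False
    then have "Suc m - n = Suc (m - n)" by simp
    then show ?thesis using False s by (simp add: x_def)
  qed
  then have "x \<in> tree_boundary f t" "x n = z"
    using assms by (auto simp: tree_boundary_iff x_def)
  then show ?thesis by blast
qed

end


section \<open>Contraction of inverse branches\<close>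

text \<open>A finite set can be avoided by a domain that is starlike about a prescribed point and
  unbounded: remove from the plane the part of each ray from \<open>q\<close> through a point of \<open>A\<close> that
  begins at this point.\<close>

lemma unbounded_starlike_avoiding:
  fixes q :: complex
  assumes "finite A" "q \<notin> A"
  obtains S where "open S" "starlike S" "q \<in> S" "S \<inter> A = {}" "\<And>R. \<exists>z\<in>S. norm z > R"
proof -
  define ray where "ray = (\<lambda>p. {z. Im ((z - q) / (p - q)) = 0 \<and> 1 \<le> Re ((z - q) / (p - q))})"
  define S where "S = - (\<Union>p\<in>A. ray p)"
  have pq: "p - q \<noteq> 0" if "p \<in> A" for p using assms(2) that by auto
  have "closed (ray p)" if "p \<in> A" for p
    unfolding ray_def by (intro closed_Collect_conj closed_Collect_eq closed_Collect_le
        continuous_intros) (use pq[OF that] in auto)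
  then have "open S"
    unfolding S_def by (intro open_Compl closed_UN assms(1)) auto
  moreover have "q \<in> S" unfolding S_def ray_def by simp
  moreover have "starlike S"
    unfolding starlike_def
  proof (intro bexI[OF _ \<open>q \<in> S\<close>] ballI subsetI)
    fix z x assume z: "z \<in> S" and "x \<in> closed_segment q z"
    then obtain u where u: "0 \<le> u" "u \<le> 1" "x = (1 - u) *\<^sub>R q + u *\<^sub>R z"
      unfolding in_segment by blast
    have xq: "x - q = of_real u * (z - q)"
      unfolding u(3) by (simp add: scaleR_conv_of_real algebra_simps)
    show "x \<in> S"
    proof (rule ccontr)
      assume "x \<notin> S"
      then obtain p where p: "p \<in> A" "x \<in> ray p" unfolding S_def by blast
      define W where "W = (z - q) / (p - q)"
      have "(x - q) / (p - q) = of_real u * W" unfolding xq W_def by simp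
      then have "Im (of_real u * W) = 0 \<and> 1 \<le> Re (of_real u * W)"
        using p(2) unfolding ray_def mem_Collect_eq by metis
      then have *: "u * Im ((z - q) / (p - q)) = 0" "1 \<le> u * Re ((z - q) / (p - q))"
        unfolding W_def[symmetric] by simp_all
      then have "u > 0" using u(1) by (cases "u = 0") auto
      moreover have "1 \<le> Re ((z - q) / (p - q))"
      proof (rule ccontr)
        assume "\<not> 1 \<le> Re ((z - q) / (p - q))"
        then have "u * Re ((z - q) / (p - q)) < u * 1"
          using \<open>u > 0\<close> by (intro mult_strict_left_mono) auto
        then show False using *(2) u(2) by linarith
      qed
      ultimately have "z \<in> ray p" using *(1) unfolding ray_def by simp
      then show False using z p(1) unfolding S_def by blast
    qed
  qed
  moreover have "S \<inter> A = {}"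
    unfolding S_def ray_def using pq by fastforce
  moreover have "\<exists>z\<in>S. norm z > R" for R
  proof -
    define L where "L = \<bar>R\<bar> + norm q + 1"
    have L: "L > 0" unfolding L_def by (smt (verit) norm_ge_zero)
    define E where "E = (\<lambda>p. q + of_real (L / norm (p - q)) * (p - q)) ` A"
    \<comment> \<open>The ray through \<open>p\<close> meets the circle of radius \<open>L\<close> about \<open>q\<close> at most once.\<close>
    have "infinite (sphere q L)"
    proof -
      have "connected (sphere q L)" by (rule connected_sphere) simp
      moreover have "q + of_real L \<in> sphere q L" "q - of_real L \<in> sphere q L"
        using L by (simp_all add: dist_norm)
      moreover have "q + of_real L \<noteq> q - of_real L"
        using L by (simp add: complex_eq_iff)
      ultimately show ?thesis by (metis connected_finite_iff_sing empty_iff singletonD)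
    qed
    moreover have "finite E" unfolding E_def using assms(1) by simp
    ultimately obtain z where z: "z \<in> sphere q L" "z \<notin> E"
      by (meson finite_subset subsetI)
    have zq: "norm (z - q) = L" using z(1) by (simp add: dist_norm norm_minus_commute)
    have "z \<in> S"
    proof (rule ccontr)
      assume "z \<notin> S"
      then obtain p where p: "p \<in> A" "z \<in> ray p" unfolding S_def by blast
      define l where "l = Re ((z - q) / (p - q))"
      have "(z - q) / (p - q) = of_real l" "l \<ge> 1"
        using p(2) unfolding ray_def l_def by (auto simp: complex_eq_iff)
      then have zl: "z - q = of_real l * (p - q)" "l \<ge> 1"
        using pq[OF p(1)] by (simp_all add: field_simps)
      then have "L = l * norm (p - q)" using zq by (simp add: norm_mult)
      then have "l = L / norm (p - q)" using pq[OF p(1)] by simp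
      then have "z = q + of_real (L / norm (p - q)) * (p - q)"
        using zl(1) by (metis add.commute diff_add_cancel)
      then show False using z(2) p(1) unfolding E_def by blast
    qed
    moreover have "norm z > R"
      using zq norm_triangle_ineq4[of z q] unfolding L_def by linarith
    ultimately show ?thesis by blast
  qed
  ultimately show ?thesis using that by blast
qed

context quadratic_pcf
begin

lemma escape_radius:
  obtains R where "R > 0" "\<And>z. norm z \<ge> R \<Longrightarrow> norm (poly f z) \<ge> 2 * norm z"
proof
  \<comment> \<open>The terms ensure \<open>norm (z - c) \<ge> norm z / 2\<close>, \<open>norm v \<le> norm z\<close> and \<open>norm a * norm z \<ge> 12\<close>.\<close>
  define R where "R = 1 + 2 * norm c + norm v + 12 / norm a"
  have "12 / norm a \<ge> 0" by simp
  then show "R > 0" unfolding R_def by (smt (verit) norm_ge_zero)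
  fix z :: complex assume z: "norm z \<ge> R"
  have z': "norm z \<ge> 2 * norm c" "norm z \<ge> norm v" "norm z \<ge> 12 / norm a"
    using z \<open>12 / norm a \<ge> 0\<close> norm_ge_zero[of c] norm_ge_zero[of v] unfolding R_def by linarith+
  have "norm (z - c) \<ge> norm z / 2"
    using norm_triangle_ineq2[of z c] z'(1) by linarith
  then have "(norm (z - c))\<^sup>2 \<ge> (norm z / 2)\<^sup>2" by (intro power_mono) auto
  then have "norm a * (norm (z - c))\<^sup>2 \<ge> norm a * (norm z / 2)\<^sup>2" by (intro mult_left_mono) auto
  moreover have "norm a * (norm z / 2)\<^sup>2 = (norm a * norm z) * norm z / 4"
    by (simp add: power2_eq_square)
  moreover have "norm a * norm z \<ge> 12"
    using z'(3) a_nonzero by (simp add: field_simps)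
  then have "(norm a * norm z) * norm z \<ge> 12 * norm z" by (intro mult_right_mono) auto
  moreover have "norm (poly f z) \<ge> norm a * (norm (z - c))\<^sup>2 - norm v"
    unfolding poly_vertex_form[of z]
    using norm_triangle_ineq2[of "a * (z - c)\<^sup>2" "- v"] by (simp add: norm_mult norm_power)
  ultimately show "norm (poly f z) \<ge> 2 * norm z" using z'(2) by linarith
qed

text \<open>Inverse branches of arbitrarily high iterates on a disc off \<open>P\<close> shrink uniformly. They form
  a normal family, extended to an unbounded domain. If a limit function were not constant, then
  by Hurwitz a value \<open>w\<close> of it at a point far out would be taken by the branches themselves, so
  that the orbit of \<open>w\<close> would return to a small disc in the region where moduli double.\<close>

lemma inverse_branches_shrink:
  assumes "q \<notin> P"
  obtains r S where "r > 0" "ball q r \<subseteq> S" "open S" "simply_connected S" "S \<inter> P = {}"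
    "\<And>e. e > 0 \<Longrightarrow> \<exists>N. \<forall>n\<ge>N. \<forall>G. inverse_branch n S G \<longrightarrow>
        (\<forall>z\<in>ball q r. dist (G z) (G q) < e)"
proof -
  obtain R where R: "R > 0" "\<And>z. norm z \<ge> R \<Longrightarrow> norm (poly f z) \<ge> 2 * norm z"
    using escape_radius by blast
  have iter: "norm (F m z) \<ge> 2 ^ m * norm z" if "norm z \<ge> R" for m z
  proof (induction m)
    case (Suc m)
    have "1 * norm z \<le> 2 ^ m * norm z" by (intro mult_right_mono) auto
    then have "norm (F m z) \<ge> R" using Suc that by linarith
    then show ?case using R(2)[of "F m z"] Suc by simp
  qed simp
  obtain S where S: "open S" "starlike S" "q \<in> S" "S \<inter> P = {}" "\<And>R. \<exists>z\<in>S. norm z > R"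
    using unbounded_starlike_avoiding[OF fin assms] by blast
  obtain r where r: "r > 0" "cball q r \<subseteq> S"
    using S(1,3) open_contains_cball by blast
  have con: "connected S" by (rule starlike_imp_connected[OF S(2)])
  have "\<exists>N. \<forall>n\<ge>N. \<forall>G. inverse_branch n S G \<longrightarrow> (\<forall>z\<in>ball q r. dist (G z) (G q) < e)"
    if e: "e > 0" for e
  proof (rule ccontr)
    assume "\<not> ?thesis"
    then have "\<forall>N. \<exists>n G. n \<ge> N \<and> inverse_branch n S G \<and> (\<exists>z\<in>ball q r. \<not> dist (G z) (G q) < e)"
      by blast
    then obtain n G where "\<forall>N. n N \<ge> N \<and> inverse_branch (n N) S (G N) \<and> (\<exists>z\<in>ball q r. \<not> dist (G N z) (G N q) < e)"
      by metis
    then have nG: "\<And>N. n N \<ge> N" "\<And>N. inverse_branch (n N) S (G N)"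
        "\<And>N. \<exists>z\<in>ball q r. \<not> dist (G N z) (G N q) < e"
      by auto
    have hol: "G N holomorphic_on S" and Fn: "\<And>z. z \<in> S \<Longrightarrow> F (n N) (G N z) = z" for N
      using nG(2)[of N] unfolding inverse_branch_def by auto
    have bounded: "\<exists>B. \<forall>h\<in>range G. \<forall>z\<in>K. norm (h z) \<le> B" if "compact K" and KS: "K \<subseteq> S" for K
    proof -
      obtain B where B: "\<And>z. z \<in> K \<Longrightarrow> norm z \<le> B"
        using compact_imp_bounded[OF \<open>compact K\<close>] unfolding bounded_iff by blast
      have "norm (G N z) \<le> max B R" if z: "z \<in> K" for N z
      proof (rule ccontr)
        assume "\<not> norm (G N z) \<le> max B R"
        then have gt: "norm (G N z) > B" "norm (G N z) \<ge> R" by auto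
        have "1 * norm (G N z) \<le> 2 ^ n N * norm (G N z)" by (intro mult_right_mono) auto
        also have "\<dots> \<le> norm (F (n N) (G N z))" by (rule iter[OF gt(2)])
        also have "F (n N) (G N z) = z" using Fn z KS by blast
        finally show False using gt(1) B[OF z] by simp
      qed
      then show ?thesis by blast
    qed
    obtain g k where g: "g holomorphic_on S" and k: "strict_mono (k :: nat \<Rightarrow> nat)"
      and unif: "\<And>K. \<lbrakk>compact K; K \<subseteq> S\<rbrakk> \<Longrightarrow> uniform_limit K (G \<circ> k) g sequentially"
    proof (rule Montel[OF S(1), of "range G" G])
      show "h holomorphic_on S" if "h \<in> range G" for h using that hol by auto
    qed (use bounded in auto)
    show False
    proof (cases "g constant_on S")
      case True
      then obtain w where w: "\<And>z. z \<in> S \<Longrightarrow> g z = w" unfolding constant_on_def by blast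
      have "\<forall>\<^sub>F i in sequentially. \<forall>z\<in>cball q r. dist ((G \<circ> k) i z) (g z) < e / 2"
        using uniform_limitD[OF unif[OF compact_cball r(2)], of "e / 2"] e by simp
      then obtain i where "\<forall>z\<in>cball q r. dist ((G \<circ> k) i z) (g z) < e / 2"
        unfolding eventually_sequentially by blast
      then have i: "\<And>z. z \<in> cball q r \<Longrightarrow> dist (G (k i) z) (g z) < e / 2"
        by simp
      obtain z where z: "z \<in> ball q r" "\<not> dist (G (k i) z) (G (k i) q) < e"
        using nG(3) by blast
      have zq: "z \<in> cball q r" "q \<in> cball q r" using z(1) r(1) by auto
      then have "dist (G (k i) z) w < e / 2" "dist (G (k i) q) w < e / 2"
        using i[OF zq(1)] i[OF zq(2)] w r(2) by (metis subsetD)+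
      then have "dist (G (k i) z) (G (k i) q) < e" by (rule dist_triangle_half_l)
      then show False using z(2) by simp
    next
      case False
      obtain z0 where z0: "z0 \<in> S" "norm z0 > R" using S(5) by blast
      obtain d0 where d0: "d0 > 0" "ball z0 d0 \<subseteq> S" using S(1) z0(1) open_contains_ball by blast
      \<comment> \<open>a disc on which moduli are at least \<open>R\<close> and vary by a factor less than 2\<close>
      define d where "d = min d0 (min (norm z0 - R) (norm z0 / 4))"
      have "norm z0 > 0" using z0(2) R(1) by linarith
      then have "d > 0" unfolding d_def using d0 z0(2) by simp
      moreover have "d \<le> d0" "d \<le> norm z0 - R" "d \<le> norm z0 / 4"
        unfolding d_def by (simp_all only: min_le_iff_disj order_refl simp_thms)
      ultimately have d: "d > 0" "d \<le> d0" "d \<le> norm z0 - R" "d \<le> norm z0 / 4" by simp_all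
      define D where "D = ball z0 d"
      have D: "open D" "connected D" "z0 \<in> D" "D \<subseteq> S"
        unfolding D_def using d d0 by auto
      have far: "norm z \<ge> R" "norm w < 2 * norm z" if "z \<in> D" "w \<in> D" for z w
      proof -
        have zw: "norm (z - z0) < d" "norm (w - z0) < d"
          using that unfolding D_def by (simp_all add: dist_norm norm_minus_commute)
        then have "norm z > norm z0 - d"
          using norm_triangle_ineq2[of z0 z] by (simp add: norm_minus_commute)
        then show "norm z \<ge> R" "norm w < 2 * norm z"
          using d norm_triangle_ineq2[of w z0] zw by linarith+
      qed
      have nc: "\<not> g constant_on D"
      proof
        assume "g constant_on D"
        then obtain w where w: "\<And>z. z \<in> D \<Longrightarrow> g z = w" unfolding constant_on_def by blast
        have "g z = w" if "z \<in> S" for z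
          by (rule analytic_continuation_open[OF D(1) S(1) _ con D(4) g holomorphic_on_const w that])
            (use D(3) in auto)
        then show False using False unfolding constant_on_def by blast
      qed
      have hit: "\<exists>i\<ge>K. \<exists>z\<in>D. G (k i) z = g z0" for K
      proof (rule ccontr)
        assume no: "\<not> ?thesis"
        have "g z0 - g z0 \<noteq> 0"
        proof (rule Hurwitz_no_zeros[OF D(1,2), where \<F> = "\<lambda>i z. G (k (i + K)) z - g z0"
              and g = "\<lambda>z. g z - g z0"])
          show "(\<lambda>z. G (k (i + K)) z - g z0) holomorphic_on D" for i
            by (intro holomorphic_intros holomorphic_on_subset[OF hol D(4)])
          show "(\<lambda>z. g z - g z0) holomorphic_on D"
            by (intro holomorphic_intros holomorphic_on_subset[OF g D(4)])
          show "uniform_limit C (\<lambda>i z. G (k (i + K)) z - g z0) (\<lambda>z. g z - g z0) sequentially"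
            if C: "compact C" "C \<subseteq> D" for C
          proof (rule uniform_limitI)
            fix e :: real assume "e > 0"
            then have "\<forall>\<^sub>F i in sequentially. \<forall>z\<in>C. dist ((G \<circ> k) i z) (g z) < e"
              using uniform_limitD[OF unif[OF C(1)]] C(2) D(4) by blast
            then have "\<forall>\<^sub>F i in sequentially. \<forall>z\<in>C. dist ((G \<circ> k) (i + K) z) (g z) < e"
              by (rule eventually_sequentially_seg[THEN iffD2])
            then show "\<forall>\<^sub>F i in sequentially. \<forall>z\<in>C. dist (G (k (i + K)) z - g z0) (g z - g z0) < e"
              by (simp add: dist_norm)
          qed
          show "\<not> (\<lambda>z. g z - g z0) constant_on D"
          proof
            assume "(\<lambda>z. g z - g z0) constant_on D"
            then obtain w where "\<And>z. z \<in> D \<Longrightarrow> g z - g z0 = w" unfolding constant_on_def by blast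
            then have "\<And>z. z \<in> D \<Longrightarrow> g z = w + g z0" by (metis diff_add_cancel)
            then show False using nc unfolding constant_on_def by blast
          qed
          show "G (k (i + K)) z - g z0 \<noteq> 0" if "z \<in> D" for i z
            using no that by (metis eq_iff_diff_eq_0 le_add2)
        qed (rule D(3))
        then show False by simp
      qed
      obtain i z where iz: "z \<in> D" "G (k i) z = g z0" using hit[of 0] by blast
      obtain j w where jw: "j \<ge> Suc (n (k i))" "w \<in> D" "G (k j) w = g z0"
        using hit[of "Suc (n (k i))"] by blast
      have lt: "n (k i) < n (k j)"
        using jw(1) nG(1)[of "k j"] strict_mono_imp_increasing[OF k, of j] by linarith
      have zw: "F (n (k i)) (g z0) = z" "F (n (k j)) (g z0) = w"
        using Fn iz jw D(4) by (metis subsetD)+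
      obtain l where l: "n (k j) = Suc l + n (k i)" using lt less_iff_Suc_add by auto
      have "w = F (Suc l) z" using zw l F_add by metis
      then have "norm w \<ge> 2 ^ Suc l * norm z" using iter[OF far(1)[OF iz(1) iz(1)]] by metis
      moreover have "(2::real) ^ Suc l * norm z \<ge> 2 * norm z"
        by (intro mult_right_mono) auto
      ultimately show False using far(2)[OF iz(1) jw(2)] by linarith
    qed
  qed
  then have shrink: "\<And>e. e > 0 \<Longrightarrow> \<exists>N. \<forall>n\<ge>N. \<forall>G. inverse_branch n S G \<longrightarrow>
      (\<forall>z\<in>ball q r. dist (G z) (G q) < e)" .
  show ?thesis
    using r(2) ball_subset_cball[of q r]
    by (intro that[OF r(1) _ S(1) starlike_imp_simply_connected[OF S(2)] S(4) shrink]) auto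
qed


text \<open>The path is cut into finitely many pieces, each in a disc on which inverse branches
  shrink.\<close>

lemma lifts_shrink:
  assumes p: "path p" "path_image p \<subseteq> - P"
  shows "\<forall>e>0. \<exists>N. \<forall>n\<ge>N. \<forall>h. is_lift n p h \<longrightarrow> (\<forall>s\<in>{0..1}. \<forall>s'\<in>{0..1}. dist (h s) (h s') < e)"
proof -
  define Q where "Q = (\<lambda>x y. {x..y} \<subseteq> {0..1} \<longrightarrow> (\<forall>e>0. \<exists>N. \<forall>n\<ge>N. \<forall>h. is_lift n p h \<longrightarrow>
      (\<forall>s\<in>{x..y}. \<forall>s'\<in>{x..y}. dist (h s) (h s') < e)))"
  have "Q 0 1"
  proof (rule Bolzano)
    fix x y z :: real
    assume trans: "Q x y" "Q y z" "x \<le> y" "y \<le> z"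
    show "Q x z"
      unfolding Q_def
    proof (intro impI allI)
      fix e :: real assume sub: "{x..z} \<subseteq> {0..1}" and e: "e > 0"
      have sub': "{x..y} \<subseteq> {0..1}" "{y..z} \<subseteq> {0..1}" using sub trans(3,4) by auto
      obtain N where N: "\<And>n h s s'. \<lbrakk>n \<ge> N; is_lift n p h; s \<in> {x..y}; s' \<in> {x..y}\<rbrakk> \<Longrightarrow> dist (h s) (h s') < e / 2"
        using trans(1) sub' half_gt_zero[OF e] unfolding Q_def by blast
      obtain M where M: "\<And>n h s s'. \<lbrakk>n \<ge> M; is_lift n p h; s \<in> {y..z}; s' \<in> {y..z}\<rbrakk> \<Longrightarrow> dist (h s) (h s') < e / 2"
        using trans(2) sub' half_gt_zero[OF e] unfolding Q_def by blast
      have "dist (h s) (h s') < e"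
        if n: "n \<ge> max N M" and h: "is_lift n p h" and s: "s \<in> {x..z}" "s' \<in> {x..z}" for n h s s'
      proof -
        have "dist (h u) (h y) < e / 2" if "u \<in> {x..z}" for u
          using N[OF _ h, of u y] M[OF _ h, of u y] n that trans(3,4) by (cases "u \<le> y") auto
        then show ?thesis using dist_triangle_half_l s by blast
      qed
      then show "\<exists>N. \<forall>n\<ge>N. \<forall>h. is_lift n p h \<longrightarrow> (\<forall>s\<in>{x..z}. \<forall>s'\<in>{x..z}. dist (h s) (h s') < e)"
        by blast
    qed
  next
    fix x :: real
    assume "0 \<le> x" "x \<le> 1"
    then have x: "x \<in> {0..1}" by simp
    have "p x \<notin> P" using p(2) x unfolding path_image_def by blast
    then obtain r S where r: "r > 0" "ball (p x) r \<subseteq> S" "open S" "simply_connected S" "S \<inter> P = {}"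
      and shrink: "\<And>e. e > 0 \<Longrightarrow> \<exists>N. \<forall>n\<ge>N. \<forall>G. inverse_branch n S G \<longrightarrow>
        (\<forall>z\<in>ball (p x) r. dist (G z) (G (p x)) < e)"
      using inverse_branches_shrink by blast
    have "continuous_on {0..1} p" using p(1) by (simp add: path_def)
    then obtain d where d: "d > 0" "\<And>s. s \<in> {0..1} \<Longrightarrow> dist s x < d \<Longrightarrow> dist (p s) (p x) < r"
      using x r(1) unfolding continuous_on_iff by blast
    have "Q y z" if yz: "y \<le> x" "x \<le> z" "z - y < d" for y z
      unfolding Q_def
    proof (intro impI allI)
      fix e :: real assume sub: "{y..z} \<subseteq> {0..1}" and e: "e > 0"
      obtain N where N: "\<And>n G z. \<lbrakk>n \<ge> N; inverse_branch n S G; z \<in> ball (p x) r\<rbrakk> \<Longrightarrow> dist (G z) (G (p x)) < e / 2"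
        using shrink[OF half_gt_zero[OF e]] by blast
      have pS: "p u \<in> ball (p x) r" if "u \<in> {y..z}" for u
        using d(2)[of u] that sub yz by (auto simp: dist_real_def dist_commute)
      have "dist (h s) (h s') < e"
        if n: "n \<ge> N" and h: "is_lift n p h" and s: "s \<in> {y..z}" "s' \<in> {y..z}" for n h s s'
      proof -
        have hx: "F n (h x) = p x" using h x unfolding is_lift_def by blast
        moreover have "p x \<in> S" using r by auto
        ultimately obtain G where G: "inverse_branch n S G" "G (p x) = h x"
          using inverse_branch_exists[OF r(3,4,5), of n "h x"] by auto
        have hG: "h u = (G \<circ> p) u" if u: "u \<in> {y..z}" for u
        proof (rule lift_unique_on[of "{y..z}" p h n "G \<circ> p" x])
          show cp: "continuous_on {y..z} p" using p(1) sub unfolding path_def by (rule continuous_on_subset)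
          show "p ` {y..z} \<subseteq> - P" using p(2) sub unfolding path_image_def by blast
          show "continuous_on {y..z} h" using h sub unfolding is_lift_def path_def
            by (blast intro: continuous_on_subset)
          show "F n (h s) = p s" if "s \<in> {y..z}" for s
            using h sub that unfolding is_lift_def by blast
          have "continuous_on S G"
            using G(1) unfolding inverse_branch_def by (simp add: holomorphic_on_imp_continuous_on)
          then show "continuous_on {y..z} (G \<circ> p)"
            using pS r(2) by (intro continuous_on_compose cp) (blast intro: continuous_on_subset)
          show "F n ((G \<circ> p) s) = p s" if "s \<in> {y..z}" for s
            using G(1) pS[OF that] r(2) unfolding inverse_branch_def by auto
        qed (use yz G(2) u in auto)
        have "dist (h u) (h x) < e / 2" if "u \<in> {y..z}" for u
          using N[OF n G(1) pS[OF that]] hG[OF that] G(2) by simp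
        then show ?thesis using dist_triangle_half_l s by blast
      qed
      then show "\<exists>N. \<forall>n\<ge>N. \<forall>h. is_lift n p h \<longrightarrow> (\<forall>s\<in>{y..z}. \<forall>s'\<in>{y..z}. dist (h s) (h s') < e)"
        by blast
    qed
    then show "\<exists>d>0. \<forall>y z. y \<le> x \<and> x \<le> z \<and> z - y < d \<longrightarrow> Q y z" using d(1) by blast
  qed simp
  then show ?thesis unfolding Q_def by simp
qed

text \<open>A closed lift inside a disc without post-critical points is contractible off \<open>P\<close>, so all its
  further lifts are closed.\<close>

lemma lifts_of_disc_closed:
  assumes p: "path_image p \<subseteq> - P" and h: "is_lift n p h" "pathfinish h = pathstart h"
    and B: "path_image h \<subseteq> B" "open B" "simply_connected B" "B \<inter> P = {}"
    and w: "F m w = pathstart h"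
  shows "lifts_to f P (n + m) p w w"
proof -
  have "pathstart h \<in> B" using B(1) by auto
  then obtain G where G: "inverse_branch m B G" "G (pathstart h) = w"
    using inverse_branch_exists[OF B(2,3,4), of m w] w by auto
  have hB: "h s \<in> B" if "s \<in> {0..1}" for s
    using B(1) that unfolding path_image_def by blast
  have "continuous_on B G"
    using G(1) unfolding inverse_branch_def by (simp add: holomorphic_on_imp_continuous_on)
  then have "continuous_on {0..1} (G \<circ> h)"
    using h(1) hB unfolding is_lift_def path_def
    by (intro continuous_on_compose) (auto intro: continuous_on_subset)
  moreover have "F (n + m) ((G \<circ> h) s) = p s" if "s \<in> {0..1}" for s
    using h(1) G(1) hB[OF that] that unfolding is_lift_def inverse_branch_def F_add by simp
  ultimately have "is_lift (n + m) p (G \<circ> h)"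
    unfolding is_lift_def path_def by blast
  then show ?thesis
    unfolding lifts_to_iff[OF p] using G(2) h(2)
    by (intro exI[of _ "G \<circ> h"]) (simp add: pathstart_compose pathfinish_compose)
qed

lemma closed_lift_below:
  assumes p: "path_image p \<subseteq> - P" and x: "x \<in> tree_boundary f t"
    and l: "lifts_to f P n p (x n) (x n)" and "m \<le> n"
  shows "lifts_to f P m p (x m) (x m)"
proof -
  obtain k where k: "n = m + k" using \<open>m \<le> n\<close> le_Suc_ex by blast
  have "F k (x n) = x m" using tree_boundary_funpow[OF x, of k m] k by simp
  then show ?thesis using lifts_to_F[OF p, of m k "x n" "x n"] l k by simp
qed

lemma trivial_on_cone:
  assumes p: "path_image p \<subseteq> - P" and h: "is_lift n p h" "pathfinish h = pathstart h"
    and B: "path_image h \<subseteq> B" "open B" "simply_connected B" "B \<inter> P = {}"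
    and x: "x \<in> tree_boundary f t" "x n = pathstart h"
  shows "lifts_to f P m p (x m) (x m)"
proof (rule closed_lift_below[OF p x(1)])
  have "F m (x (n + m)) = pathstart h" using tree_boundary_funpow[OF x(1), of m n] x(2) by simp
  then show "lifts_to f P (n + m) p (x (n + m)) (x (n + m))"
    by (rule lifts_of_disc_closed[OF p h B])
qed simp

text \<open>The closed lifts of \<open>p\<close> along \<open>y\<close> are mapped to one another by \<open>f\<close>.\<close>

lemma coherent_closed_lifts:
  assumes p: "p \<in> loops (- P) t" and y: "y \<in> tree_boundary f t"
    and cl: "\<And>n. lifts_to f P n p (y n) (y n)"
  shows "\<exists>h. \<forall>n. is_lift n p (h n) \<and> pathstart (h n) = y n \<and> pathfinish (h n) = y n \<and>
    (\<forall>s\<in>{0..1}. poly f (h (Suc n) s) = h n s)"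
proof -
  note p' = loopsD[OF p]
  have "\<forall>n. \<exists>h. is_lift n p h \<and> pathstart h = y n \<and> pathfinish h = y n"
    using cl unfolding lifts_to_iff[OF p'(2)] by blast
  then obtain h where h: "\<And>n. is_lift n p (h n)" "\<And>n. pathstart (h n) = y n" "\<And>n. pathfinish (h n) = y n"
    by metis
  have "poly f (h (Suc n) s) = h n s" if s: "s \<in> {0..1}" for n s
  proof -
    have "is_lift n p (F 1 \<circ> h (Suc n))" using is_lift_F[of n 1 p "h (Suc n)"] h(1)[of "Suc n"] by simp
    moreover have "(F 1 \<circ> h (Suc n)) 0 = h n 0"
      using h(2)[of n] h(2)[of "Suc n"] y by (simp add: pathstart_def tree_boundary_iff)
    ultimately have "(F 1 \<circ> h (Suc n)) s = h n s"
      using is_lift_unique[OF p'(1,2) _ h(1), of n _ 0 s] s by simp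
    then show ?thesis by simp
  qed
  then show ?thesis using h by (intro exI[of _ h]) blast
qed


section \<open>The periodic case\<close>

text \<open>The return map \<open>F k\<close> is quadratic to leading order at \<open>c\<close>, hence contracts near \<open>c\<close>; in between,
  the iterates up to \<open>k\<close> are equicontinuous at \<open>c\<close>.\<close>

lemma stable_critical_point:
  assumes k: "k \<ge> 1" "F k c = c" and e: "e > 0"
  shows "\<exists>d>0. \<forall>z. dist z c < d \<longrightarrow> (\<forall>n. dist (F n z) (F n c) < e)"
proof -
  have gv: "F (k - 1) v = c" using k F_v[of "k - 1"] by simp
  have "F (k - 1) field_differentiable at v"
    using F_holomorphic[of "k - 1" UNIV] holomorphic_on_imp_differentiable_at by blast
  then obtain D where "(F (k - 1) has_field_derivative D) (at v)"
    unfolding field_differentiable_def by blast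
  then have "(F (k - 1) has_derivative (\<lambda>x. D * x)) (at v)"
    by (simp add: has_field_derivative_def)
  then obtain r where r: "r > 0"
    "\<And>w. norm (w - v) < r \<Longrightarrow> norm (F (k - 1) w - F (k - 1) v - D * (w - v)) \<le> 1 * norm (w - v)"
    unfolding has_derivative_at_alt by (meson zero_less_one)
  define L where "L = norm D + 1"
  have L: "L > 0" unfolding L_def by (smt (verit) norm_ge_zero)
  have lip: "norm (F (k - 1) w - c) \<le> L * norm (w - v)" if "norm (w - v) < r" for w
  proof -
    have "norm (F (k - 1) w - c) \<le> norm (F (k - 1) w - c - D * (w - v)) + norm (D * (w - v))"
      using norm_triangle_ineq[of "F (k - 1) w - c - D * (w - v)" "D * (w - v)"] by simp
    also have "\<dots> \<le> 1 * norm (w - v) + norm D * norm (w - v)"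
      using r(2)[OF that] gv by (simp add: norm_mult)
    finally show ?thesis unfolding L_def by (simp add: algebra_simps)
  qed
  define d1 where "d1 = min 1 (min (r / norm a) (1 / (L * norm a)))"
  have na: "norm a > 0" using a_nonzero by simp
  have d1: "d1 > 0" unfolding d1_def using r(1) L na by simp
  have contract: "norm (F k z - c) \<le> norm (z - c)" if z: "norm (z - c) < d1" for z
  proof -
    have z': "norm (z - c) < 1" "norm (z - c) < r / norm a" "norm (z - c) < 1 / (L * norm a)"
      using z unfolding d1_def by simp_all
    have fz: "norm (poly f z - v) = norm a * (norm (z - c) * norm (z - c))"
      by (simp add: poly_vertex_form[of z] norm_mult norm_power power2_eq_square)
    have "norm (z - c) * norm (z - c) \<le> 1 * norm (z - c)"
      using z'(1) by (intro mult_right_mono) auto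
    then have "norm a * (norm (z - c) * norm (z - c)) \<le> norm a * norm (z - c)"
      using na by simp
    also have "\<dots> < r" using z'(2) na by (simp add: field_simps)
    finally have "norm (poly f z - v) < r" unfolding fz .
    then have "norm (F (k - 1) (poly f z) - c) \<le> L * norm (poly f z - v)" by (rule lip)
    also have "\<dots> = (L * norm a * norm (z - c)) * norm (z - c)" unfolding fz by simp
    also have "\<dots> \<le> 1 * norm (z - c)"
      using z'(3) L na by (intro mult_right_mono) (auto simp: field_simps)
    finally show ?thesis using k(1) F_Suc[of "k - 1" z] by simp
  qed
  have iter: "norm (F (k * m) z - c) \<le> norm (z - c)" if z: "norm (z - c) < d1" for m z
  proof (induction m)
    case (Suc m)
    have "F (k * Suc m) z = F k (F (k * m) z)" using F_add[of k "k * m" z] by simp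
    moreover have "norm (F k (F (k * m) z) - c) \<le> norm (F (k * m) z - c)"
      using Suc z by (intro contract) linarith
    ultimately show ?case using Suc by simp
  qed simp
  have per: "F (k * m) c = c" for m
    using iter[of c m] d1 by simp
  have "\<forall>\<^sub>F z in nhds c. \<forall>i\<in>{..<k}. dist (F i z) (F i c) < e"
  proof (rule eventually_ball_finite)
    show "\<forall>i\<in>{..<k}. \<forall>\<^sub>F z in nhds c. dist (F i z) (F i c) < e"
    proof
      fix i
      have "isCont (F i) c" using F_continuous[of UNIV i] continuous_on_eq_continuous_at by blast
      then have "(F i \<longlongrightarrow> F i c) (nhds c)" by (simp add: isCont_def tendsto_nhds_iff)
      then show "\<forall>\<^sub>F z in nhds c. dist (F i z) (F i c) < e" using e by (rule tendstoD)
    qed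
  qed simp
  then obtain d2 where d2: "d2 > 0" "\<And>z i. dist z c < d2 \<Longrightarrow> i < k \<Longrightarrow> dist (F i z) (F i c) < e"
    unfolding eventually_nhds_metric by blast
  have "dist (F n z) (F n c) < e" if z: "dist z c < min d1 d2" for n z
  proof -
    have n: "n = n mod k + k * (n div k)" by simp
    have eq: "F n w = F (n mod k) (F (k * (n div k)) w)" for w
      using F_add[of "n mod k" "k * (n div k)" w] by simp
    have "dist (F (k * (n div k)) z) c < d2"
      using iter[of z "n div k"] z by (simp add: dist_norm)
    then have "dist (F (n mod k) (F (k * (n div k)) z)) (F (n mod k) c) < e"
      using k(1) by (intro d2(2)) auto
    then show ?thesis unfolding eq per .
  qed
  then show ?thesis using d1 d2(1) by (intro exI[of _ "min d1 d2"]) auto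
qed

lemma stable_pullback:
  assumes st: "\<And>e. e > 0 \<Longrightarrow> \<exists>d>0. \<forall>z. dist z (F i w) < d \<longrightarrow> (\<forall>n. dist (F n z) (F n (F i w)) < e)"
    and e: "e > 0"
  shows "\<exists>d>0. \<forall>z. dist z w < d \<longrightarrow> (\<forall>n. dist (F n z) (F n w) < e)"
  using st e
proof (induction i arbitrary: w e)
  case 0
  then show ?case by simp
next
  case (Suc i)
  have "\<exists>d>0. \<forall>z. dist z (poly f w) < d \<longrightarrow> (\<forall>n. dist (F n z) (F n (poly f w)) < e)"
    using Suc.IH[of "poly f w" e] Suc.prems unfolding F_Suc by blast
  then obtain d where d: "d > 0" "\<And>z n. dist z (poly f w) < d \<Longrightarrow> dist (F n z) (F n (poly f w)) < e"
    by blast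
  have "isCont (poly f) w" by simp
  then obtain d' where d': "d' > 0" "\<And>z. dist z w < d' \<Longrightarrow> dist (poly f z) (poly f w) < d"
    using d(1) unfolding continuous_at_eps_delta by blast
  have "dist (F n z) (F n w) < e" if "dist z w < min d' e" for n z
  proof (cases n)
    case (Suc m)
    then show ?thesis using d(2)[OF d'(2), of z m] that unfolding Suc F_Suc by simp
  qed (use that in simp)
  then show ?case using d' \<open>e > 0\<close> by (intro exI[of _ "min d' e"]) auto
qed

text \<open>A cycle through the critical point is superattracting, so that lifted loops stay at a
  definite distance from it. Being short, they eventually lie in discs without post-critical
  points.\<close>

lemma Hausdorff_periodic:
  assumes k: "k \<ge> 1" "F k c = c"
  shows "Hausdorff_space (IMG_groupoid f c t)"
proof (rule Hausdorff_IMG_groupoid)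
  fix p y
  assume p: "p \<in> loops (- P) t" and y: "y \<in> tree_boundary f t"
    and cl: "\<And>n. lifts_to f P n p (y n) (y n)"
  note p' = loopsD[OF p]
  obtain h where h: "\<And>n. is_lift n p (h n)" "\<And>n. pathstart (h n) = y n" "\<And>n. pathfinish (h n) = y n"
    using coherent_closed_lifts[OF p y cl] by metis
  have "\<exists>e>0. \<forall>x\<in>path_image p. \<forall>w\<in>P. e \<le> dist x w"
    by (rule separate_compact_closed) (use p' fin finite_imp_closed in \<open>auto simp: compact_path_image\<close>)
  then obtain e where e: "e > 0" "\<And>x w. x \<in> path_image p \<Longrightarrow> w \<in> P \<Longrightarrow> e \<le> dist x w" by blast
  have "\<exists>d>0. \<forall>z. dist z w < d \<longrightarrow> (\<forall>n. dist (F n z) (F n w) < e)" if w: "w \<in> P" for w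
  proof -
    obtain m where m: "w = F m c" using w unfolding post_critical_orbit_def by blast
    have per: "F (k * j) c = c" for j
    proof (induction j)
      case (Suc j)
      then show ?case using F_add[of k "k * j" c] k(2) by simp
    qed simp
    have "k * m = (k * m - m) + m" using k(1) by simp
    then have "F (k * m - m) w = c" using F_add[of "k * m - m" m c] per[of m] m by simp
    then show ?thesis
      using stable_pullback[of "k * m - m" w e] stable_critical_point[OF k] e(1) by simp
  qed
  then obtain d where d: "\<And>w. w \<in> P \<Longrightarrow> d w > 0"
    "\<And>w z n. w \<in> P \<Longrightarrow> dist z w < d w \<Longrightarrow> dist (F n z) (F n w) < e"
    by metis
  define D where "D = Min (d ` P)"
  have ne: "P \<noteq> {}" using v_in_P by blast
  have D: "D > 0" "\<And>w. w \<in> P \<Longrightarrow> D \<le> d w"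
    unfolding D_def using fin ne d(1) by auto
  have far: "D \<le> dist (h n s) w" if "s \<in> {0..1}" "w \<in> P" for n s w
  proof (rule ccontr)
    assume "\<not> D \<le> dist (h n s) w"
    then have "dist (F n (h n s)) (F n w) < e" using d(2)[OF that(2), of "h n s" n] D(2)[OF that(2)] by simp
    moreover have "F n (h n s) = p s" using h(1) that(1) unfolding is_lift_def by blast
    moreover have "p s \<in> path_image p" using that(1) unfolding path_image_def by blast
    ultimately show False using e(2)[of "p s" "F n w"] F_in_P[OF that(2), of n] by simp
  qed
  obtain N where N: "\<And>h s s'. is_lift N p h \<Longrightarrow> s \<in> {0..1} \<Longrightarrow> s' \<in> {0..1} \<Longrightarrow> dist (h s) (h s') < D"
    using lifts_shrink[OF p'(1,2)] D(1) by blast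
  have y0: "y N = h N 0" using h(2)[of N] by (simp add: pathstart_def)
  have im: "path_image (h N) \<subseteq> ball (y N) D"
    unfolding path_image_def y0 using N[OF h(1), of 0] by auto
  have "ball (y N) D \<inter> P = {}" using far[of 0 _ N] unfolding y0 by fastforce
  then have "\<forall>x\<in>tree_boundary f t. x N = y N \<longrightarrow> (\<forall>n. lifts_to f P n p (x n) (x n))"
    using trivial_on_cone[OF p'(2) h(1) _ im] h(2,3) by (simp add: convex_imp_simply_connected)
  then show "\<exists>N. (\<forall>x\<in>tree_boundary f t. x N = y N \<longrightarrow> (\<forall>n. lifts_to f P n p (x n) (x n))) \<or>
         (\<forall>x\<in>tree_boundary f t. x N = y N \<longrightarrow> x \<noteq> y \<longrightarrow> (\<exists>n. \<not> lifts_to f P n p (x n) (x n)))"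
    by blast
qed


section \<open>A post-critical orbit with two points\<close>

lemma F_v_noteq_v:
  assumes np: "\<not> (\<exists>k\<ge>1. F k c = c)" and "i \<ge> 1"
  shows "F i v \<noteq> v"
proof
  assume "F i v = v"
  moreover obtain j where j: "i = Suc j" using \<open>i \<ge> 1\<close> by (cases i) auto
  ultimately have "poly f (F j v) = v" by simp
  then have "F j v = c" by (simp only: poly_eq_v_iff)
  then have "F i c = c" unfolding j F_v .
  then show False using np \<open>i \<ge> 1\<close> by blast
qed

lemma c_notin_P:
  assumes np: "\<not> (\<exists>k\<ge>1. F k c = c)"
  shows "c \<notin> P"
proof
  assume "c \<in> P"
  then obtain m where "m \<ge> 1" "c = F m c" unfolding post_critical_orbit_def by blast
  then show False using np by metis
qed

lemma post_critical_orbit_card_less_3: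
  assumes np: "\<not> (\<exists>k\<ge>1. F k c = c)" and card: "card P < 3"
  shows "P = {v, poly f v}" "poly f (poly f v) = poly f v" "poly f v \<noteq> v"
proof -
  define w where "w = poly f v"
  have wv: "w \<noteq> v" using F_v_noteq_v[OF np, of 1] unfolding w_def by simp
  have fwv: "poly f w \<noteq> v" using F_v_noteq_v[OF np, of 2] unfolding w_def by (simp add: numeral_2_eq_2)
  have inP: "w \<in> P" "poly f w \<in> P"
    using F_in_P[OF v_in_P, of 1] F_in_P[OF v_in_P, of 2] unfolding w_def by (simp_all add: numeral_2_eq_2)
  have ww: "poly f w = w"
  proof (rule ccontr)
    assume "poly f w \<noteq> w"
    then have "card {v, w, poly f w} = 3" using wv fwv by simp
    moreover have "card {v, w, poly f w} \<le> card P"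
      by (rule card_mono[OF fin]) (use inP v_in_P in blast)
    ultimately show False using card by simp
  qed
  have "F n v \<in> {v, w}" for n
  proof (induction n)
    case (Suc n)
    then have "F n v = v \<or> F n v = w" by simp
    then show ?case using ww by (elim disjE) (simp_all add: w_def)
  qed simp
  then have "z \<in> {v, w}" if "z \<in> P" for z
    using that unfolding in_P_iff by metis
  then have "P = {v, w}" using inP(1) v_in_P by (intro equalityI subsetI) auto
  then show "P = {v, poly f v}" "poly f (poly f v) = poly f v" "poly f v \<noteq> v"
    using ww wv unfolding w_def by simp_all
qed

text \<open>Put \<open>w = poly f v\<close>, a fixed point whose other preimage is \<open>v\<close>. If some short closed lift along
  \<open>y\<close> is not close to \<open>P\<close>, the loop fixes a cone around \<open>y\<close>. Otherwise all short closed lifts \<open>h\<close> along \<open>y\<close> stay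
  near \<open>w\<close>, since a lift near \<open>v\<close> has its preimages near \<open>c\<close>. A boundary point \<open>x\<close> that branches off
  from \<open>y\<close> passes to a lift near \<open>v\<close>, namely \<open>2 * c - h\<close>, and from there to a lift near \<open>c\<close>, which is
  closed if and only if \<open>w - h\<close> is \<open>a\<close> times the square of a closed path. This condition is the same on
  all high levels, because \<open>f w - f z\<close> is \<open>w - z\<close> times the square of a function without zeros near
  \<open>w\<close>. Hence the loop fixes all points near \<open>y\<close>, or none of them except \<open>y\<close>.\<close>

lemma Hausdorff_card_less_3:
  assumes np: "\<not> (\<exists>k\<ge>1. F k c = c)" and card: "card P < 3"
  shows "Hausdorff_space (IMG_groupoid f c t)"
proof (rule Hausdorff_IMG_groupoid)
  fix p y
  assume p: "p \<in> loops (- P) t" and y: "y \<in> tree_boundary f t"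
    and cl: "\<And>n. lifts_to f P n p (y n) (y n)"
  note p' = loopsD[OF p]
  obtain h where H: "\<forall>n. is_lift n p (h n) \<and> pathstart (h n) = y n \<and> pathfinish (h n) = y n \<and>
    (\<forall>s\<in>{0..1}. poly f (h (Suc n) s) = h n s)"
    using coherent_closed_lifts[OF p y cl] by blast
  then have h: "\<And>n. is_lift n p (h n)" "\<And>n. pathstart (h n) = y n" "\<And>n. pathfinish (h n) = y n"
    and fh: "\<And>n s. s \<in> {0..1} \<Longrightarrow> poly f (h (Suc n) s) = h n s"
    by blast+
  define w where "w = poly f v"
  have P: "P = {v, w}" and fw: "poly f w = w" and wv: "w \<noteq> v"
    using post_critical_orbit_card_less_3[OF np card] unfolding w_def by auto
  have vw: "v = 2 * c - w"
    using fw wv w_def poly_eq_iff_pm[of v w] by auto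
  define d where "d = norm (w - c)"
  have cv: "norm (v - c) = d"
  proof -
    have "v - c = - (w - c)" unfolding vw by simp
    then show ?thesis unfolding d_def by (simp only: norm_minus_cancel)
  qed
  have d: "d > 0" using wv vw unfolding d_def by auto
  have dwv: "norm (w - v) = 2 * d"
  proof -
    have "w - v = 2 * (w - c)" using vw by (simp add: algebra_simps)
    show ?thesis unfolding d_def \<open>w - v = 2 * (w - c)\<close> norm_mult by simp
  qed
  \<comment> \<open>The disc of radius \<open>e'\<close> about \<open>c\<close> is far from \<open>P\<close>, and it contains the preimage of the disc of
    radius \<open>2 * e\<close> about \<open>v\<close>.\<close>
  define e' where "e' = d / 4"
  define e where "e = min (e' / 2) (norm a * e'\<^sup>2 / 2)"
  have na: "norm a > 0" using a_nonzero by simp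
  have e': "e' > 0" using d unfolding e'_def by simp
  have e: "e > 0" "2 * e \<le> e'" "2 * e \<le> norm a * e'\<^sup>2"
    unfolding e_def using e' na by (auto simp: min_def)
  have near_c: "norm (z - c) < e'" if "norm (poly f z - v) < 2 * e" for z
  proof -
    have "norm a * (norm (z - c))\<^sup>2 < norm a * e'\<^sup>2"
      using that e(3) by (simp add: poly_vertex_form[of z] norm_mult norm_power)
    then have "(norm (z - c))\<^sup>2 < e'\<^sup>2" using na by simp
    then show ?thesis using e' by (simp add: power_less_imp_less_base)
  qed
  have far_P: "3 * e' < norm (z - u)" if "norm (z - c) < e'" "u \<in> P" for z u
  proof -
    have "norm (u - c) = d" using that(2) cv unfolding P d_def by auto
    then have "norm (u - z) \<ge> d - norm (z - c)"
      using norm_triangle_ineq2[of "u - c" "z - c"] by simp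
    then show ?thesis using that(1) unfolding e'_def by (simp add: norm_minus_commute)
  qed
  obtain N where N: "\<And>n h s s'. n \<ge> N \<Longrightarrow> is_lift n p h \<Longrightarrow> s \<in> {0..1} \<Longrightarrow> s' \<in> {0..1} \<Longrightarrow> dist (h s) (h s') < e"
    using lifts_shrink[OF p'(1,2)] e(1) by blast
  have y0: "h n 0 = y n" for n using h(2)[of n] by (simp add: pathstart_def)
  have fy: "poly f (y (Suc n)) = y n" for n using y by (simp add: tree_boundary_iff)
  show "\<exists>N. (\<forall>x\<in>tree_boundary f t. x N = y N \<longrightarrow> (\<forall>n. lifts_to f P n p (x n) (x n))) \<or>
         (\<forall>x\<in>tree_boundary f t. x N = y N \<longrightarrow> x \<noteq> y \<longrightarrow> (\<exists>n. \<not> lifts_to f P n p (x n) (x n)))"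
  proof (cases "\<exists>n\<ge>N. ball (y n) e \<inter> P = {}")
    case True
    then obtain n where n: "n \<ge> N" "ball (y n) e \<inter> P = {}" by blast
    have im: "path_image (h n) \<subseteq> ball (y n) e"
      unfolding path_image_def y0[symmetric] using N[OF n(1) h(1), of 0] by auto
    have "\<forall>x\<in>tree_boundary f t. x n = y n \<longrightarrow> (\<forall>m. lifts_to f P m p (x m) (x m))"
      using trivial_on_cone[OF p'(2) h(1) _ im] h(2,3) n(2) by (simp add: convex_imp_simply_connected)
    then show ?thesis by blast
  next
    case False
    have near: "\<exists>u\<in>P. norm (y n - u) < e" if "n \<ge> N" for n
      using False that by (auto simp: dist_norm)
    have yw: "norm (y n - w) < e" if n: "n \<ge> N" for n
    proof (rule ccontr)
      assume "\<not> norm (y n - w) < e"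
      then have "norm (y n - v) < e" using near[OF n] unfolding P by blast
      then have "norm (poly f (y (Suc n)) - v) < 2 * e" unfolding fy using e(1) by linarith
      then have *: "norm (y (Suc n) - c) < e'" by (rule near_c)
      obtain u where "u \<in> P" "norm (y (Suc n) - u) < e" using near[of "Suc n"] n by auto
      then show False using far_P[OF *, of u] e' e(2) by linarith
    qed
    have hw: "norm (h n s - w) < 2 * e" if "n \<ge> N" "s \<in> {0..1}" for n s
    proof -
      have "norm (h n s - y n) < e" using N[OF that(1) h(1) that(2), of 0] by (simp add: dist_norm y0)
      then show ?thesis using yw[OF that(1)] norm_triangle_ineq[of "h n s - y n" "y n - w"] by simp
    qed
    \<comment> \<open>the parity of the winding number of \<open>h n\<close> around \<open>w\<close>, in the form of a square root\<close>
    define Sq where "Sq = (\<lambda>n. \<exists>r. path r \<and> r 1 = r 0 \<and> (\<forall>s\<in>{0..1}. a * (r s)\<^sup>2 = w - h n s))"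
    have Sq_step: "Sq n \<longleftrightarrow> Sq (Suc n)" if n: "n \<ge> N" for n
    proof -
      have hn: "w - h n s = (w - h (Suc n) s) * (a * (h (Suc n) s - v))" if s: "s \<in> {0..1}" for s
      proof -
        have "w - h n s = poly f w - poly f (h (Suc n) s)" using fw fh[OF s] by simp
        also have "\<dots> = (w - h (Suc n) s) * (a * (h (Suc n) s - (2 * c - w)))"
          unfolding poly_vertex_form[of w] poly_vertex_form[of "h (Suc n) s"]
          by (simp add: power2_eq_square algebra_simps)
        finally show ?thesis unfolding vw[symmetric] .
      qed
      define B where "B = ball w (2 * e)"
      have ne: "a * (z - v) \<noteq> 0" if "z \<in> B" for z
        using that dwv e(2) d a_nonzero unfolding B_def e'_def by (auto simp: dist_norm)
      have hB: "h (Suc n) s \<in> B" if "s \<in> {0..1}" for s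
        using hw[OF _ that, of "Suc n"] n unfolding B_def by (simp add: dist_norm norm_minus_commute)
      have B: "simply_connected B" "locally path_connected B"
        unfolding B_def by (simp_all add: convex_imp_simply_connected open_imp_locally_path_connected)
      have "(\<lambda>z. a * (z - v)) holomorphic_on B" by (intro holomorphic_intros)
      then obtain u where u: "u holomorphic_on B" "\<And>z. z \<in> B \<Longrightarrow> a * (z - v) = (u z)\<^sup>2"
        using simply_connected_imp_holomorphic_sqrt[of "\<lambda>z. a * (z - v)" B, OF _ B ne] by blast
      define U where "U = u \<circ> h (Suc n)"
      have U: "continuous_on {0..1} U" "U 1 = U 0"
        "\<And>s. s \<in> {0..1} \<Longrightarrow> (U s)\<^sup>2 = a * (h (Suc n) s - v)" "\<And>s. s \<in> {0..1} \<Longrightarrow> U s \<noteq> 0"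
      proof -
        have "continuous_on {0..1} (h (Suc n))" using h(1) unfolding is_lift_def path_def by blast
        moreover have "continuous_on (h (Suc n) ` {0..1}) u"
          using holomorphic_on_imp_continuous_on[OF u(1)] hB by (blast intro: continuous_on_subset)
        ultimately show "continuous_on {0..1} U" unfolding U_def by (rule continuous_on_compose)
        show "U 1 = U 0"
          using h(2,3)[of "Suc n"] unfolding U_def by (simp add: pathstart_def pathfinish_def)
        show sq: "(U s)\<^sup>2 = a * (h (Suc n) s - v)" if "s \<in> {0..1}" for s
          using u(2)[OF hB[OF that]] unfolding U_def by simp
        show "U s \<noteq> 0" if "s \<in> {0..1}" for s
          using sq[OF that] ne[OF hB[OF that]] by (metis zero_power2)
      qed
      show ?thesis
      proof
        assume "Sq n"
        then obtain r where r: "path r" "r 1 = r 0" "\<And>s. s \<in> {0..1} \<Longrightarrow> a * (r s)\<^sup>2 = w - h n s"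
          unfolding Sq_def by blast
        have "path (\<lambda>s. r s / U s)"
          using r(1) U unfolding path_def by (intro continuous_on_divide) auto
        moreover have "a * (r s / U s)\<^sup>2 = w - h (Suc n) s" if s: "s \<in> {0..1}" for s
        proof -
          have "a * (r s)\<^sup>2 = (w - h (Suc n) s) * (U s)\<^sup>2"
            using r(3)[OF s] hn[OF s] U(3)[OF s] by simp
          then show ?thesis using U(4)[OF s] by (simp add: power_divide)
        qed
        ultimately show "Sq (Suc n)"
          unfolding Sq_def using r(2) U(2) by (intro exI[of _ "\<lambda>s. r s / U s"]) simp
      next
        assume "Sq (Suc n)"
        then obtain r where r: "path r" "r 1 = r 0" "\<And>s. s \<in> {0..1} \<Longrightarrow> a * (r s)\<^sup>2 = w - h (Suc n) s"
          unfolding Sq_def by blast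
        have "path (\<lambda>s. r s * U s)"
          using r(1) U unfolding path_def by (intro continuous_on_mult) auto
        moreover have "a * (r s * U s)\<^sup>2 = w - h n s" if s: "s \<in> {0..1}" for s
          using r(3)[OF s] hn[OF s] U(3)[OF s] by (simp add: power_mult_distrib flip: mult.assoc)
        ultimately show "Sq n"
          unfolding Sq_def using r(2) U(2) by (intro exI[of _ "\<lambda>s. r s * U s"]) simp
      qed
    qed
    have Sq_iff: "Sq n \<longleftrightarrow> Sq N" if "n \<ge> N" for n
      using that
    proof (induction n rule: dec_induct)
      case (step m)
      then show ?case using Sq_step[of m] by blast
    qed (rule refl)
    have branch: "(Sq N \<longrightarrow> (\<forall>m. lifts_to f P m p (x m) (x m))) \<and>
        (lifts_to f P (Suc (Suc n)) p (x (Suc (Suc n))) (x (Suc (Suc n))) \<longrightarrow> Sq N)"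
      if n: "n \<ge> N" and x: "x \<in> tree_boundary f t" and xy: "x n = y n" "x (Suc n) \<noteq> y (Suc n)" for n x
    proof -
      have fx: "poly f (x (Suc m)) = x m" for m using x by (simp add: tree_boundary_iff)
      have "poly f (x (Suc n)) = poly f (y (Suc n))" using fx fy xy(1) by simp
      then have "x (Suc n) = y (Suc n) \<or> x (Suc n) = 2 * c - y (Suc n)"
        by (simp only: poly_eq_iff_pm)
      then have x1: "x (Suc n) = 2 * c - y (Suc n)" using xy(2) by blast
      define k where "k = (\<lambda>s. 2 * c - h (Suc n) s)"
      have k: "is_lift (Suc n) p k"
      proof -
        have "path k" using h(1)[of "Suc n"] unfolding k_def is_lift_def path_def
          by (intro continuous_on_diff continuous_on_const) blast
        moreover have "F (Suc n) (k s) = p s" if "s \<in> {0..1}" for s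
        proof -
          have "F (Suc n) (k s) = F (Suc n) (h (Suc n) s)" unfolding F_Suc k_def poly_reflect ..
          then show ?thesis using h(1)[of "Suc n"] that unfolding is_lift_def by metis
        qed
        ultimately show ?thesis unfolding is_lift_def by blast
      qed
      have k0: "k 0 = x (Suc n)" unfolding k_def y0 x1 ..
      have kv: "k s - v = w - h (Suc n) s" for s unfolding k_def vw by simp
      have "\<forall>m. lifts_to f P m p (x m) (x m)" if "Sq N"
      proof -
        have "Sq (Suc n)" using that Sq_iff[of "Suc n"] n by simp
        then obtain r where r: "path r" "r 1 = r 0" "\<And>s. s \<in> {0..1} \<Longrightarrow> a * (r s)\<^sup>2 = w - h (Suc n) s"
          unfolding Sq_def by blast
        have "a * (x (Suc (Suc n)) - c)\<^sup>2 = poly f (x (Suc (Suc n))) - v"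
          by (simp add: poly_vertex_form[of "x (Suc (Suc n))"])
        also have "\<dots> = k 0 - v" unfolding fx k0 ..
        also have "\<dots> = a * (r 0)\<^sup>2" using r(3)[of 0] kv by simp
        finally have "(x (Suc (Suc n)) - c)\<^sup>2 = (r 0)\<^sup>2" using a_nonzero by simp
        then consider "x (Suc (Suc n)) - c = r 0" | "x (Suc (Suc n)) - c = - r 0"
          by (auto simp: power2_eq_iff)
        then obtain \<sigma> where \<sigma>: "\<sigma>\<^sup>2 = 1" "x (Suc (Suc n)) - c = \<sigma> * r 0"
        proof cases
          case 1
          then show ?thesis using that[of 1] by simp
        next
          case 2
          then show ?thesis using that[of "-1"] by simp
        qed
        define l where "l = (\<lambda>s. \<sigma> * r s + c)"
        have fl: "poly f (l s) = k s" if s: "s \<in> {0..1}" for s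
        proof -
          have "poly f (l s) = a * (\<sigma>\<^sup>2 * (r s)\<^sup>2) + v"
            by (simp add: l_def poly_vertex_form[of "_ + c"] power_mult_distrib)
          also have "\<dots> = k s" unfolding \<sigma>(1) mult_1 r(3)[OF s] kv[of s, symmetric] by simp
          finally show ?thesis .
        qed
        have l: "is_lift (Suc (Suc n)) p l"
        proof -
          have "path l" using r(1) unfolding l_def path_def by (intro continuous_intros)
          moreover have "F (Suc (Suc n)) (l s) = p s" if "s \<in> {0..1}" for s
            using k that fl[OF that] unfolding F_Suc[of "Suc n"] is_lift_def by simp
          ultimately show ?thesis unfolding is_lift_def by blast
        qed
        have im: "path_image l \<subseteq> ball c e'"
        proof -
          have "norm (l s - c) < e'" if "s \<in> {0..1}" for s
          proof (rule near_c)
            have "norm (poly f (l s) - v) = norm (h (Suc n) s - w)"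
              unfolding fl[OF that] kv by (rule norm_minus_commute)
            then show "norm (poly f (l s) - v) < 2 * e" using hw[OF _ that, of "Suc n"] n by simp
          qed
          then show ?thesis unfolding path_image_def by (auto simp: dist_norm norm_minus_commute)
        qed
        have disj: "ball c e' \<inter> P = {}"
        proof (rule ccontr)
          assume "ball c e' \<inter> P \<noteq> {}"
          then obtain z where "z \<in> P" "norm (z - c) < e'" by (auto simp: dist_norm norm_minus_commute)
          then show False using far_P[of z z] e' by simp
        qed
        have "pathfinish l = pathstart l" using r(2) unfolding l_def pathfinish_def pathstart_def by simp
        moreover have "x (Suc (Suc n)) = pathstart l"
          using \<sigma>(2) unfolding l_def pathstart_def by (metis diff_add_cancel)
        ultimately show ?thesis
          using trivial_on_cone[OF p'(2) l _ im _ _ disj x] by (simp add: convex_imp_simply_connected)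
      qed
      moreover have "Sq N" if closed: "lifts_to f P (Suc (Suc n)) p (x (Suc (Suc n))) (x (Suc (Suc n)))"
      proof -
        obtain r where r: "is_lift (Suc (Suc n)) p r" "pathstart r = x (Suc (Suc n))" "pathfinish r = x (Suc (Suc n))"
          using closed unfolding lifts_to_iff[OF p'(2)] by blast
        have "is_lift (Suc n) p (F 1 \<circ> r)" using is_lift_F[of "Suc n" 1 p r] r(1) by simp
        moreover have "(F 1 \<circ> r) 0 = k 0"
          using r(2) fx[of "Suc n"] k0 by (simp add: pathstart_def)
        ultimately have fr: "(F 1 \<circ> r) s = k s" if "s \<in> {0..1}" for s
          using is_lift_unique[OF p'(1,2) _ k, of _ 0 s] that by simp
        have "a * (r s - c)\<^sup>2 = w - h (Suc n) s" if "s \<in> {0..1}" for s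
        proof -
          have "a * (r s - c)\<^sup>2 = poly f (r s) - v" by (simp add: poly_vertex_form[of "r s"])
          also have "poly f (r s) = k s" using fr[OF that] by simp
          finally show ?thesis unfolding kv .
        qed
        moreover have "path (\<lambda>s. r s - c)"
          using r(1) unfolding is_lift_def path_def by (intro continuous_intros) auto
        moreover have "r 1 - c = r 0 - c" using r(2,3) by (simp add: pathstart_def pathfinish_def)
        ultimately have "Sq (Suc n)" unfolding Sq_def by (intro exI[of _ "\<lambda>s. r s - c"]) blast
        then show ?thesis using Sq_iff[of "Suc n"] n by simp
      qed
      ultimately show ?thesis by blast
    qed
    have split: "\<exists>n\<ge>N. x n = y n \<and> x (Suc n) \<noteq> y (Suc n)"
      if x: "x \<in> tree_boundary f t" "x N = y N" "x \<noteq> y" for x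
    proof (rule ccontr)
      assume no: "\<not> ?thesis"
      have up: "x (N + m) = y (N + m)" for m
      proof (induction m)
        case (Suc m)
        then show ?case using no by (metis add_Suc_right le_add1)
      qed (use x in simp)
      have "x m = y m" for m
        using tree_boundary_funpow[OF x(1), of N m] tree_boundary_funpow[OF y, of N m] up[of m]
        by (simp add: add.commute)
      then show False using x(3) by blast
    qed
    show ?thesis
    proof (cases "Sq N")
      case True
      have "\<forall>m. lifts_to f P m p (x m) (x m)" if x: "x \<in> tree_boundary f t" "x N = y N" for x
      proof (cases "x = y")
        case False
        then show ?thesis using split[OF x] branch x(1) True by blast
      qed (use cl in simp)
      then show ?thesis by blast
    next
      case False
      have "\<exists>n. \<not> lifts_to f P n p (x n) (x n)"
        if x: "x \<in> tree_boundary f t" "x N = y N" "x \<noteq> y" for x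
        using split[OF x] branch x(1) False by blast
      then show ?thesis by blast
    qed
  qed
qed

end


section \<open>Strictly pre-periodic orbits with at least three points\<close>

lemma no_closed_sqrt_on_circle:
  fixes r :: "real \<Rightarrow> complex"
  assumes r: "continuous_on {0..1} r" "r 1 = r 0"
    and sq: "\<And>s. s \<in> {0..1} \<Longrightarrow> (r s)\<^sup>2 = of_real l * exp (2 * of_real pi * \<i> * of_real s)"
    and l: "l > 0"
  shows False
proof -
  define T where "T = (\<lambda>s. r s / exp (of_real pi * \<i> * of_real s))"
  have T: "(T s)\<^sup>2 = of_real l" if "s \<in> {0..1}" for s
  proof -
    have "(exp (of_real pi * \<i> * of_real s))\<^sup>2 = exp (2 * of_real pi * \<i> * of_real s)"
      by (simp add: algebra_simps flip: exp_double)
    then show ?thesis unfolding T_def power_divide sq[OF that] by simp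
  qed
  have "continuous_on {0..1} T"
    unfolding T_def by (intro continuous_intros r) simp
  moreover have "finite (T ` {0..1})"
  proof (rule finite_subset)
    show "T ` {0..1} \<subseteq> {csqrt (of_real l), - csqrt (of_real l)}"
    proof
      fix z assume "z \<in> T ` {0..1}"
      then have "z\<^sup>2 = (csqrt (of_real l))\<^sup>2" using T by auto
      then show "z \<in> {csqrt (of_real l), - csqrt (of_real l)}" unfolding power2_eq_iff by blast
    qed
  qed simp
  ultimately have "T constant_on {0..1}"
    using continuous_finite_range_constant[of "{0..1::real}" T] by simp
  then have T01: "T 0 = T 1" unfolding constant_on_def by fastforce
  have "T 1 = - r 0" unfolding T_def r(2) by simp
  moreover have "T 0 = r 0" unfolding T_def by simp
  ultimately have "r 0 = 0" using T01 by simp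
  then show False using sq[of 0] l by simp
qed

context quadratic_pcf
begin

lemma card_poly_fibre: "z \<noteq> c \<Longrightarrow> card {u. poly f u = poly f z} = 2"
proof -
  assume "z \<noteq> c"
  then have "2 * c - z \<noteq> z" by (metis add_diff_cancel_left' mult_2 diff_eq_eq mult_left_cancel zero_neq_numeral)
  moreover have "{u. poly f u = poly f z} = {z, 2 * c - z}" unfolding poly_eq_iff_pm by blast
  ultimately show ?thesis by simp
qed

text \<open>The full preimage of \<open>P\<close> has \<open>2 * card P - 1\<close> points, among them \<open>c\<close> and those of \<open>P\<close>, so
  that \<open>card P - 2\<close> points remain.\<close>

lemma extra_preimage:
  assumes np: "\<not> (\<exists>k\<ge>1. F k c = c)" and card: "card P \<ge> 3"
  shows "\<exists>z. z \<notin> P \<and> z \<noteq> c \<and> poly f z \<in> P"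
proof (rule ccontr)
  assume no: "\<not> ?thesis"
  have cP: "c \<notin> P" by (rule c_notin_P[OF np])
  define fib where "fib = (\<lambda>u. {z. poly f z = u})"
  have fib: "fib u \<subseteq> P" "card (fib u) = 2" if u: "u \<in> P - {v}" for u
  proof -
    obtain z where z: "poly f z = u" using surj_poly by blast
    then have "z \<noteq> c" using u by blast
    then show "card (fib u) = 2" using card_poly_fibre[of z] z unfolding fib_def by simp
    show "fib u \<subseteq> P"
    proof
      fix x assume "x \<in> fib u"
      then have "poly f x = u" unfolding fib_def by simp
      then show "x \<in> P" using no u by blast
    qed
  qed
  have "P = (\<Union>u\<in>P - {v}. fib u)"
  proof
    show "P \<subseteq> (\<Union>u\<in>P - {v}. fib u)"
    proof
      fix z assume z: "z \<in> P"
      have "poly f z \<in> P" using F_in_P[OF z, of 1] by simp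
      moreover have "poly f z \<noteq> v" using z cP unfolding poly_eq_v_iff by blast
      ultimately show "z \<in> (\<Union>u\<in>P - {v}. fib u)" unfolding fib_def by blast
    qed
    show "(\<Union>u\<in>P - {v}. fib u) \<subseteq> P" using fib(1) by blast
  qed
  moreover have "card (\<Union>u\<in>P - {v}. fib u) = (\<Sum>u\<in>P - {v}. card (fib u))"
  proof (rule card_UN_disjoint)
    show "\<forall>u\<in>P - {v}. finite (fib u)" using fib(1) fin finite_subset by blast
    show "\<forall>u\<in>P - {v}. \<forall>u'\<in>P - {v}. u \<noteq> u' \<longrightarrow> fib u \<inter> fib u' = {}" unfolding fib_def by blast
  qed (use fin in simp)
  moreover have "(\<Sum>u\<in>P - {v}. card (fib u)) = 2 * (card P - 1)"
    using fib(2) v_in_P fin by simp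
  ultimately show False using card by simp
qed

lemma eventually_periodic:
  obtains M K where "K \<ge> 1" "F (M + K) v = F M v"
proof -
  have "finite (range (\<lambda>n. F n v))"
    by (rule finite_subset[OF _ fin]) (use F_v_in_P in blast)
  then have "\<not> inj (\<lambda>n. F n v)" using finite_imageD infinite_UNIV_nat by blast
  then obtain i j where "i \<noteq> j" "F i v = F j v" unfolding inj_def by blast
  then obtain i j where ij: "i < j" "F i v = F j v" by (metis linorder_neqE_nat)
  then obtain k where "j = i + Suc k" using less_iff_Suc_add by auto
  then show ?thesis using that[of "Suc k" i] ij(2) by simp
qed

text \<open>Inverse branches along a backward orbit of \<open>\<rho>\<close> exist on a whole disc about \<open>\<rho>\<close>, even if \<open>\<rho>\<close> is
  post-critical, as long as the backward orbit avoids \<open>v\<close> before its last step.\<close>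

lemma inverse_branch_extend:
  assumes B: "open B" "simply_connected B" "B \<inter> P \<subseteq> {\<rho>}" "\<rho> \<in> B"
    and G: "inverse_branch n B G" and w: "F m w = G \<rho>" "\<And>i. 1 \<le> i \<Longrightarrow> i \<le> m \<Longrightarrow> F i w \<noteq> v"
  shows "\<exists>H. inverse_branch (n + m) B H \<and> (\<forall>z\<in>B. F m (H z) = G z) \<and> H \<rho> = w"
proof -
  have "G z \<notin> P" if "z \<in> B" "z \<noteq> \<rho>" for z
  proof (rule notin_P_pullback[of n])
    show "F n (G z) \<notin> P" using G that B(3) unfolding inverse_branch_def by auto
  qed
  then obtain H where H: "H holomorphic_on B" "\<forall>z\<in>B. F m (H z) = G z" "H \<rho> = w"
    using holomorphic_lift[of B G \<rho> m w] B(1,2,4) w G unfolding inverse_branch_def by blast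
  then have "inverse_branch (n + m) B H"
    using G unfolding inverse_branch_def by (simp add: F_add)
  then show ?thesis using H by blast
qed

text \<open>A lasso: the loop that runs along \<open>\<delta>\<close> to a point near \<open>\<rho>\<close>, once around a circle about \<open>\<rho>\<close>, and
  back along \<open>\<delta>\<close>. The circle lies in a disc \<open>B\<close> whose only possible post-critical point is \<open>\<rho>\<close>.\<close>

context
  fixes \<rho> t :: complex and \<epsilon> :: real and \<delta> :: "real \<Rightarrow> complex"
  assumes \<epsilon>: "\<epsilon> > 0" and BP: "ball \<rho> \<epsilon> \<inter> P \<subseteq> {\<rho>}"
    and \<delta>: "path \<delta>" "path_image \<delta> \<subseteq> - P" "pathstart \<delta> = t" "pathfinish \<delta> = \<rho> + of_real (\<epsilon> / 2)"
begin

abbreviation B :: "complex set" where "B \<equiv> ball \<rho> \<epsilon>"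

abbreviation b :: complex where "b \<equiv> \<rho> + of_real (\<epsilon> / 2)"

text \<open>The circle, of half the radius of the disc and with initial point \<open>b\<close>.\<close>

definition circ :: "real \<Rightarrow> complex" where "circ = circlepath \<rho> (\<epsilon> / 2)"

text \<open>The lasso is based at \<open>t\<close>.\<close>

definition lasso :: "real \<Rightarrow> complex" where "lasso = \<delta> +++ (circ +++ reversepath \<delta>)"

lemma circ: "path circ" "path_image circ \<subseteq> B" "path_image circ \<subseteq> - P" "pathstart circ = b" "pathfinish circ = b"
proof -
  show "path circ" "pathstart circ = b" "pathfinish circ = b" unfolding circ_def by simp_all
  have im: "path_image circ = sphere \<rho> (\<epsilon> / 2)" unfolding circ_def using \<epsilon> by simp
  then show "path_image circ \<subseteq> B" using \<epsilon> by auto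
  have "\<rho> \<notin> path_image circ" unfolding im using \<epsilon> by simp
  then show "path_image circ \<subseteq> - P" using BP \<open>path_image circ \<subseteq> B\<close> by blast
qed

lemma b_in_B: "b \<in> B"
  using circ(2) pathstart_in_path_image[of circ] unfolding circ(4) by blast

lemma lasso: "lasso \<in> loops (- P) t"
proof -
  have "path_image (circ +++ reversepath \<delta>) \<subseteq> - P"
    using circ(3) \<delta>(2) path_image_join_subset[of circ "reversepath \<delta>"] by auto
  then have "path_image lasso \<subseteq> - P"
    unfolding lasso_def using \<delta>(2) path_image_join_subset[of \<delta> "circ +++ reversepath \<delta>"] by blast
  moreover have "path lasso" unfolding lasso_def using \<delta> circ by simp
  ultimately show ?thesis unfolding loops_def using \<delta> circ by (simp add: lasso_def)
qed

lemma reverse_\<delta>: "path (reversepath \<delta>)" "path_image (reversepath \<delta>) \<subseteq> - P"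
  using \<delta> by simp_all

lemma tail_unique:
  assumes "lifts_to f P n \<delta> z u" "lifts_to f P n \<delta> z' u"
  shows "z = z'"
  using lifts_to_unique[OF reverse_\<delta>] assms unfolding lifts_to_reversepath[OF \<delta>(2)] by blast

lemma tail_exists:
  assumes "inverse_branch n B G"
  shows "\<exists>z. lifts_to f P n \<delta> z (G b)"
proof -
  have "F n (G b) = pathstart (reversepath \<delta>)"
    using assms b_in_B \<delta>(4) unfolding inverse_branch_def by simp
  then show ?thesis
    using lifts_to_exists[OF reverse_\<delta>] unfolding lifts_to_reversepath[OF \<delta>(2)] by blast
qed

lemma circ_lift:
  assumes "inverse_branch n B G"
  shows "is_lift n circ (G \<circ> circ)"
proof -
  have "circ s \<in> B" if "s \<in> {0..1}" for s
    using circ(2) that unfolding path_image_def by blast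
  moreover have "continuous_on B G"
    using assms unfolding inverse_branch_def by (simp add: holomorphic_on_imp_continuous_on)
  then have "path (G \<circ> circ)"
    by (intro path_continuous_image circ(1)) (rule continuous_on_subset[OF _ circ(2)])
  ultimately show ?thesis
    using assms unfolding is_lift_def inverse_branch_def by simp
qed

text \<open>Inverse branches on the whole disc, including \<open>\<rho>\<close>, give closed lifts of the lasso.\<close>

lemma lasso_closed:
  assumes G: "inverse_branch n B G" and z: "lifts_to f P n \<delta> z (G b)"
  shows "lifts_to f P n lasso z z"
proof -
  have "lifts_to f P n circ (G b) (G b)"
    unfolding lifts_to_iff[OF circ(3)] using circ_lift[OF G] circ(4,5)
    by (intro exI[of _ "G \<circ> circ"]) (simp add: pathstart_compose pathfinish_compose)
  moreover have "lifts_to f P n (reversepath \<delta>) (G b) z"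
    unfolding lifts_to_reversepath[OF \<delta>(2)] by (rule z)
  ultimately have "lifts_to f P n (circ +++ reversepath \<delta>) (G b) z"
    using lifts_to_join[OF circ(3) reverse_\<delta>(2)] by blast
  moreover have "path_image (circ +++ reversepath \<delta>) \<subseteq> - P"
    using circ(3) \<delta>(2) path_image_join_subset[of circ "reversepath \<delta>"] by auto
  ultimately show ?thesis
    unfolding lasso_def using lifts_to_join[OF \<delta>(2) _ z] by blast
qed

text \<open>If the disc is lifted off \<open>P\<close>, then it lifts further without obstruction, so that the lasso
  fixes the whole cone.\<close>

lemma lasso_trivial:
  assumes G: "inverse_branch n B G" "G \<rho> \<notin> P" and z: "lifts_to f P n \<delta> z (G b)"
    and x: "x \<in> tree_boundary f t" "x n = z"
  shows "lifts_to f P m lasso (x m) (x m)"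
proof (rule closed_lift_below[OF loopsD(2)[OF lasso] x(1)])
  have notP: "G u \<notin> P" if "u \<in> B" for u
  proof (cases "u = \<rho>")
    case False
    then have "F n (G u) \<notin> P" using that G(1) BP unfolding inverse_branch_def by auto
    then show ?thesis by (rule notin_P_pullback)
  qed (use G(2) in simp)
  have Fx: "F m (x (n + m)) = z" using tree_boundary_funpow[OF x(1), of m n] x(2) by simp
  have "F (n + m) (x (n + m)) = pathstart \<delta>"
    using tree_boundary_level[OF x(1), of "n + m"] \<delta>(3) unfolding level_def by simp
  then obtain u where u: "lifts_to f P (n + m) \<delta> (x (n + m)) u"
    using lifts_to_exists[OF \<delta>(1,2)] by blast
  have "lifts_to f P n \<delta> z (F m u)" using lifts_to_F[OF \<delta>(2) u] unfolding Fx .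
  then have Fu: "F m u = G b" using lifts_to_unique[OF \<delta>(1,2)] z by blast
  obtain H where H: "H holomorphic_on B" "\<forall>z\<in>B. F m (H z) = G z" "H b = u"
    using holomorphic_lift_avoiding[of B G b m u] G(1) notP b_in_B Fu
    unfolding inverse_branch_def by (auto simp: convex_imp_simply_connected)
  then have "inverse_branch (n + m) B H"
    using G(1) unfolding inverse_branch_def by (simp add: F_add)
  then show "lifts_to f P (n + m) lasso (x (n + m)) (x (n + m))"
    by (rule lasso_closed) (use u H(3) in simp)
qed simp

text \<open>If the disc is lifted to a neighbourhood of \<open>v\<close>, then the next lift is not closed: \<open>G - v\<close> has a
  simple zero at \<open>\<rho>\<close>, so it has no continuous square root on the circle.\<close>

lemma lasso_not_closed:
  assumes G: "inverse_branch n B G" "G \<rho> = v" and z: "lifts_to f P n \<delta> z (G b)"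
    and \<zeta>: "poly f \<zeta> = z"
  shows "\<not> lifts_to f P (Suc n) lasso \<zeta> \<zeta>"
proof
  assume l: "lifts_to f P (Suc n) lasso \<zeta> \<zeta>"
  have im: "path (circ +++ reversepath \<delta>)" "path_image (circ +++ reversepath \<delta>) \<subseteq> - P"
    using circ \<delta> path_image_join_subset[of circ "reversepath \<delta>"] by auto
  obtain u where u: "lifts_to f P (Suc n) \<delta> \<zeta> u" "lifts_to f P (Suc n) (circ +++ reversepath \<delta>) u \<zeta>"
    using lifts_to_joinD[OF \<delta>(1,2) im _ l[unfolded lasso_def]] \<delta>(4) circ(4) by auto
  obtain u' where u': "lifts_to f P (Suc n) circ u u'" "lifts_to f P (Suc n) (reversepath \<delta>) u' \<zeta>"
    using lifts_to_joinD[OF circ(1,3) reverse_\<delta> _ u(2)] \<delta>(4) circ(5) by auto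
  have "u' = u"
    using lifts_to_unique[OF \<delta>(1,2) _ u(1)] u'(2) unfolding lifts_to_reversepath[OF \<delta>(2)] by blast
  then obtain r where r: "is_lift (Suc n) circ r" "pathstart r = u" "pathfinish r = u"
    using u'(1) unfolding lifts_to_iff[OF circ(3)] by blast
  have "lifts_to f P n \<delta> z (poly f u)"
    using lifts_to_F[OF \<delta>(2), of n 1 \<zeta> u] u(1) \<zeta> by simp
  then have fu: "poly f u = G b" using lifts_to_unique[OF \<delta>(1,2)] z by blast
  have lift: "is_lift n circ (F 1 \<circ> r)" using is_lift_F[of n 1 circ r] r(1) by simp
  have eq0: "(F 1 \<circ> r) 0 = (G \<circ> circ) 0"
    using fu r(2) circ(4) by (simp add: pathstart_def)
  have fr: "poly f (r s) = G (circ s)" if "s \<in> {0..1}" for s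
    using is_lift_unique[OF circ(1,3) lift circ_lift[OF G(1)] _ eq0 that] by simp
  have circ_B: "circ s \<in> B" if "s \<in> {0..1}" for s
    using circ(2) that unfolding path_image_def by blast
  have holG: "(\<lambda>z. G z - v) holomorphic_on B"
    using G(1) unfolding inverse_branch_def by (intro holomorphic_intros) blast
  have \<rho>B: "\<rho> \<in> B" using \<epsilon> by simp
  define U where "U = (\<lambda>z. if z = \<rho> then deriv (\<lambda>z. G z - v) \<rho> else (G z - v) / (z - \<rho>))"
  have U: "G z - v = (z - \<rho>) * U z" for z unfolding U_def using G(2) by simp
  have holU: "U holomorphic_on B"
    by (rule pole_theorem_open_0[OF holG open_ball, of \<rho>]) (use U G(2) in \<open>auto simp: U_def\<close>)
  have "deriv (\<lambda>z. G z - v) \<rho> = deriv G \<rho>"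
  proof -
    have "G field_differentiable at \<rho>"
      using G(1) \<rho>B unfolding inverse_branch_def
      by (blast intro: holomorphic_on_imp_differentiable_at)
    then show ?thesis by simp
  qed
  then have U\<rho>: "U \<rho> \<noteq> 0"
    using inverse_branch_deriv_nonzero(2)[OF G(1) open_ball \<rho>B] unfolding U_def by simp
  have Unz: "U z \<noteq> 0" if "z \<in> B" for z
  proof (cases "z = \<rho>")
    case False
    then have "G z \<noteq> G \<rho>" using inj_onD[OF inverse_branch_inj[OF G(1)] _ that \<rho>B] by blast
    then show ?thesis using U[of z] G(2) by auto
  qed (use U\<rho> in simp)
  have "simply_connected B" "locally path_connected B"
    by (simp_all add: convex_imp_simply_connected open_imp_locally_path_connected)
  then obtain e where e: "e holomorphic_on B" "\<And>z. z \<in> B \<Longrightarrow> U z = (e z)\<^sup>2"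
    using simply_connected_imp_holomorphic_sqrt[of U B, OF holU _ _ Unz] by blast
  have enz: "e z \<noteq> 0" if "z \<in> B" for z using e(2)[OF that] Unz[OF that] by auto
  define R where "R = (\<lambda>s. (r s - c) * csqrt a / e (circ s))"
  show False
  proof (rule no_closed_sqrt_on_circle)
    have "continuous_on {0..1} (e \<circ> circ)"
      using circ(1) circ_B holomorphic_on_imp_continuous_on[OF e(1)] unfolding path_def
      by (intro continuous_on_compose) (auto intro: continuous_on_subset)
    moreover have "continuous_on {0..1} r" using r(1) unfolding is_lift_def path_def by blast
    ultimately show "continuous_on {0..1} R"
      unfolding R_def by (intro continuous_intros) (use enz circ_B in auto)
    show "R 1 = R 0"
      using r(2,3) circ(4,5) unfolding R_def pathstart_def pathfinish_def by simp
    show "(R s)\<^sup>2 = of_real (\<epsilon> / 2) * exp (2 * of_real pi * \<i> * of_real s)" if s: "s \<in> {0..1}" for s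
    proof -
      have "a * (r s - c)\<^sup>2 = (circ s - \<rho>) * (e (circ s))\<^sup>2"
      proof -
        have "a * (r s - c)\<^sup>2 = poly f (r s) - v" by (simp add: poly_vertex_form[of "r s"])
        also have "\<dots> = (circ s - \<rho>) * U (circ s)" unfolding fr[OF s] U ..
        finally show ?thesis unfolding e(2)[OF circ_B[OF s]] .
      qed
      then have "(R s)\<^sup>2 = circ s - \<rho>"
        using enz[OF circ_B[OF s]] unfolding R_def
        by (simp add: power_divide power_mult_distrib mult.commute)
      then show ?thesis unfolding circ_def circlepath by simp
    qed
  qed (use \<epsilon> in simp)
qed

end

text \<open>The loop is a lasso around a periodic point \<open>\<rho>\<close> of \<open>P\<close>, and \<open>y\<close> runs through its lifts around
  the points \<open>\<rho>n n\<close> of the cycle. Both \<open>v\<close> and the point from \<open>extra_preimage\<close> are iterated preimages of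
  \<open>\<rho>n n\<close>, for every \<open>n\<close>. Branching off from \<open>y\<close> towards \<open>v\<close> gives points close to \<open>y\<close> that the lasso
  moves, branching off towards the other point gives cones close to \<open>y\<close> that it fixes.\<close>

lemma not_Hausdorff_preperiodic:
  assumes np: "\<not> (\<exists>k\<ge>1. F k c = c)" and card: "card P \<ge> 3" and t: "t \<notin> P"
  shows "\<not> Hausdorff_space (IMG_groupoid f c t)"
proof -
  obtain M K where K: "K \<ge> 1" "F (M + K) v = F M v" by (rule eventually_periodic)
  define \<rho> where "\<rho> = F M v"
  have K\<rho>: "F K \<rho> = \<rho>" using K(2) F_add[of K M v] unfolding \<rho>_def by (simp add: add.commute)
  have KK\<rho>: "F (K * j) \<rho> = \<rho>" for j
  proof (induction j)
    case (Suc j)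
    then show ?case using F_add[of K "K * j" \<rho>] K\<rho> by simp
  qed simp
  have cyc: "F i \<rho> \<noteq> v" for i
  proof -
    have "F i \<rho> = F (i + (K + M)) v" using K\<rho> F_add[of K M v] F_add[of i "K + M" v] unfolding \<rho>_def by simp
    then show ?thesis using F_v_noteq_v[OF np, of "i + (K + M)"] K(1) by simp
  qed
  have "\<exists>e>0. \<forall>z\<in>P. z \<noteq> \<rho> \<longrightarrow> e \<le> dist \<rho> z" by (rule finite_set_avoid[OF fin])
  then obtain e where e: "e > 0" "\<And>z. z \<in> P \<Longrightarrow> z \<noteq> \<rho> \<Longrightarrow> e \<le> dist \<rho> z" by blast
  have BP: "ball \<rho> e \<inter> P \<subseteq> {\<rho>}" using e(2) by force
  have B: "open (ball \<rho> e)" "simply_connected (ball \<rho> e)" "connected (ball \<rho> e)" "\<rho> \<in> ball \<rho> e"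
    using e(1) by (simp_all add: convex_imp_simply_connected)
  have "\<rho> + of_real (e / 2) \<in> - P"
  proof -
    have "\<rho> + of_real (e / 2) \<in> ball \<rho> e" "\<rho> + of_real (e / 2) \<noteq> \<rho>" using e(1) by (simp_all add: dist_norm)
    then show ?thesis using BP by blast
  qed
  moreover have "path_connected (- P)"
    by (rule path_connected_complement_countable) (use fin in \<open>simp_all add: countable_finite\<close>)
  ultimately obtain \<delta> where \<delta>: "path \<delta>" "path_image \<delta> \<subseteq> - P" "pathstart \<delta> = t" "pathfinish \<delta> = \<rho> + of_real (e / 2)"
    using t unfolding path_connected_def by blast
  define p where "p = lasso \<rho> e \<delta>"
  note L = e(1) BP \<delta>
  have p: "p \<in> loops (- P) t" unfolding p_def by (rule lasso[OF L])
  \<comment> \<open>On the cycle, \<open>n\<close> steps backward are \<open>(K - 1) * n\<close> steps forward.\<close>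
  define \<rho>n where "\<rho>n = (\<lambda>n. F ((K - 1) * n) \<rho>)"
  have f\<rho>n: "poly f (\<rho>n (Suc n)) = \<rho>n n" for n
  proof -
    have "Suc ((K - 1) * Suc n) = (K - 1) * n + K" using K(1) by (cases K) simp_all
    then have "F (Suc ((K - 1) * Suc n)) \<rho> = F ((K - 1) * n) (F K \<rho>)" using F_add by metis
    then show ?thesis unfolding \<rho>n_def K\<rho> by simp
  qed
  have F\<rho>n: "F n (\<rho>n n) = \<rho>" for n
  proof (induction n)
    case (Suc n)
    then show ?case unfolding F_Suc f\<rho>n .
  qed (simp add: \<rho>n_def)
  have cycn: "F i (\<rho>n n) \<noteq> v" for i n
    unfolding \<rho>n_def F_add[symmetric] by (rule cyc)
  have id: "inverse_branch 0 (ball \<rho> e) (\<lambda>z. z)" unfolding inverse_branch_def by simp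
  have "\<exists>G. inverse_branch n (ball \<rho> e) G \<and> G \<rho> = \<rho>n n" for n
    using inverse_branch_extend[OF B(1,2) BP B(4) id F\<rho>n] cycn by fastforce
  then obtain G where G: "\<And>n. inverse_branch n (ball \<rho> e) (G n)" "\<And>n. G n \<rho> = \<rho>n n" by metis
  have bB: "\<rho> + of_real (e / 2) \<in> ball \<rho> e" by (rule b_in_B[OF L])
  have fG: "poly f (G (Suc n) z) = G n z" if z: "z \<in> ball \<rho> e" for n z
  proof -
    have "inverse_branch n (ball \<rho> e) (poly f \<circ> G (Suc n))"
      using G(1)[of "Suc n"] unfolding inverse_branch_def F_Suc
      by (auto intro!: holomorphic_on_compose holomorphic_intros)
    moreover have "(poly f \<circ> G (Suc n)) \<rho> = G n \<rho>" using G(2) f\<rho>n by simp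
    ultimately have "(poly f \<circ> G (Suc n)) z = G n z"
      using inverse_branch_unique[OF _ G(1) B(1,3) B(4) _ z] by blast
    then show ?thesis by simp
  qed
  define b where "b = \<rho> + of_real (e / 2)"
  have "\<exists>z. lifts_to f P n \<delta> z (G n b)" for n unfolding b_def by (rule tail_exists[OF L G(1)])
  then obtain y where yG: "\<And>n. lifts_to f P n \<delta> (y n) (G n b)" by metis
  have down: "F m z = y n" if "lifts_to f P (n + m) \<delta> z u" "F m u = G n b" for m n z u
    using tail_unique[OF L _ yG] lifts_to_F[OF \<delta>(2) that(1)] that(2) by metis
  have "y 0 = t" using lifts_to_endpoints(1)[OF yG[of 0]] \<delta>(3) by simp
  moreover have "poly f (y (Suc n)) = y n" for n
    using down[of n 1 "y (Suc n)" "G (Suc n) b"] yG[of "Suc n"] fG[OF bB, of n] unfolding b_def by simp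
  ultimately have y: "y \<in> tree_boundary f t" by (simp add: tree_boundary_iff)
  \<comment> \<open>From any vertex of \<open>y\<close> on, a backward orbit of \<open>\<rho>\<close> that avoids \<open>v\<close> can be followed.\<close>
  have follow: "\<exists>H z. inverse_branch (n + m) (ball \<rho> e) H \<and> H \<rho> = w \<and>
      lifts_to f P (n + m) \<delta> z (H b) \<and> F m z = y n"
    if w: "F m w = \<rho>n n" "\<And>i. 1 \<le> i \<Longrightarrow> i \<le> m \<Longrightarrow> F i w \<noteq> v" for n m w
  proof -
    have "F m w = G n \<rho>" using w(1) G(2) by simp
    then obtain H where H: "inverse_branch (n + m) (ball \<rho> e) H" "\<forall>z\<in>ball \<rho> e. F m (H z) = G n z" "H \<rho> = w"
      using inverse_branch_extend[OF B(1,2) BP B(4) G(1), of m w n] w(2) by blast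
    obtain z where z: "lifts_to f P (n + m) \<delta> z (H b)"
      using tail_exists[OF L H(1)] unfolding b_def by blast
    have "F m (H b) = G n b" using H(2) bB unfolding b_def by blast
    then have "F m z = y n" by (rule down[OF z])
    then show ?thesis using H z by blast
  qed
  have level: "F n z = t" if "lifts_to f P n \<delta> z u" for n z u
    using lifts_to_endpoints(1)[OF that] \<delta>(3) by simp
  show ?thesis
  proof (rule not_Hausdorff_IMG_groupoid[OF p y])
    fix N
    define j where "j = (K - 1) * N + M"
    have "F j v = \<rho>n N" unfolding j_def F_add \<rho>n_def \<rho>_def ..
    moreover have "F i v \<noteq> v" if "1 \<le> i" "i \<le> j" for i by (rule F_v_noteq_v[OF np that(1)])
    ultimately obtain H z where H: "inverse_branch (N + j) (ball \<rho> e) H" "H \<rho> = v"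
      "lifts_to f P (N + j) \<delta> z (H b)" "F j z = y N"
      using follow by blast
    obtain \<zeta> where \<zeta>: "poly f \<zeta> = z" using surj_poly by blast
    have "F (Suc (N + j)) \<zeta> = t" unfolding F_Suc \<zeta> by (rule level[OF H(3)])
    then obtain x where x: "x \<in> tree_boundary f t" "x (Suc (N + j)) = \<zeta>" using vertex_extends by blast
    have "F (Suc j) (x (N + Suc j)) = x N" by (rule tree_boundary_funpow[OF x(1)])
    then have "x N = y N" using x(2) H(4) unfolding F_Suc by (simp add: \<zeta>)
    moreover have "\<not> lifts_to f P (Suc (N + j)) p (x (Suc (N + j))) (x (Suc (N + j)))"
      unfolding x(2) p_def using lasso_not_closed[OF L H(1,2) H(3)[unfolded b_def] \<zeta>] .
    ultimately show "\<exists>x\<in>tree_boundary f t. x N = y N \<and> (\<exists>n. \<not> lifts_to f P n p (x n) (x n))"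
      using x(1) by blast
  next
    fix N
    obtain x0 where x0: "x0 \<notin> P" "x0 \<noteq> c" "poly f x0 \<in> P" using extra_preimage[OF np card] by blast
    obtain j where j: "poly f x0 = F j v" using x0(3) in_P_iff by blast
    have x0v: "F i x0 \<noteq> v" if "1 \<le> i" for i
    proof (cases "i = 1")
      case True
      then show ?thesis using x0(2) by (simp add: poly_eq_v_iff)
    next
      case False
      then obtain l where l: "i = Suc l" "l \<ge> 1" using \<open>1 \<le> i\<close> by (cases i) auto
      have "F i x0 = F (l + j) v" unfolding l(1) F_Suc j F_add ..
      then show ?thesis using F_v_noteq_v[OF np, of "l + j"] l(2) by simp
    qed
    \<comment> \<open>Since \<open>poly f x0 = F j v\<close>, the orbit of \<open>poly f x0\<close> is at \<open>\<rho>n N\<close> after \<open>l\<close> steps; the multiple of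
      \<open>K\<close> only serves to make the difference nonnegative.\<close>
    define l where "l = (K - 1) * N + K * j + M - j"
    have "K * j \<ge> j" using K(1) by simp
    then have "j \<le> (K - 1) * N + K * j + M" by linarith
    then have "l + j = (K - 1) * N + K * j + M" unfolding l_def by (rule le_add_diff_inverse2)
    then have lj: "l + j = (K - 1) * N + (K * j + M)" by (simp only: add.assoc)
    have "F (Suc l) x0 = F (l + j) v" unfolding F_Suc j F_add ..
    also have "\<dots> = F ((K - 1) * N) (F (K * j) \<rho>)" unfolding lj F_add \<rho>_def ..
    also have "\<dots> = \<rho>n N" unfolding KK\<rho> \<rho>n_def ..
    finally have Fx0: "F (Suc l) x0 = \<rho>n N" .
    obtain H z where H: "inverse_branch (N + Suc l) (ball \<rho> e) H" "H \<rho> = x0"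
      "lifts_to f P (N + Suc l) \<delta> z (H b)" "F (Suc l) z = y N"
      using follow[OF Fx0] x0v by blast
    obtain x where x: "x \<in> tree_boundary f t" "x (N + Suc l) = z"
      using vertex_extends[OF level[OF H(3)]] by blast
    have "x N = y N" using tree_boundary_funpow[OF x(1), of "Suc l" N] unfolding x(2) H(4) by simp
    moreover have "lifts_to f P n p (x' n) (x' n)"
      if "x' \<in> tree_boundary f t" "x' (N + Suc l) = x (N + Suc l)" for x' n
      unfolding p_def
      using lasso_trivial[OF L H(1) _ H(3)[unfolded b_def] that(1)] that(2) x(2) H(2) x0(1) by simp
    ultimately show "\<exists>M\<ge>N. \<exists>x\<in>tree_boundary f t. x N = y N \<and>
       (\<forall>x'\<in>tree_boundary f t. x' M = x M \<longrightarrow> (\<forall>n. lifts_to f P n p (x' n) (x' n)))"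
      using x(1) by (intro exI[of _ "N + Suc l"]) auto
  qed
qed

end

section \<open>The dichotomy\<close>

theorem theorem1p5:
  fixes f :: "complex poly" and c t :: complex
  assumes "degree f = 2"
    and "poly (pderiv f) c = 0"
    and "finite (post_critical_orbit f c)"
    and "t \<notin> post_critical_orbit f c"
  shows "(\<not> Hausdorff_space (IMG_groupoid f c t) \<longleftrightarrow>
            strictly_preperiodic f c \<and> card (post_critical_orbit f c) \<ge> 3) \<and>
         (\<not> (strictly_preperiodic f c \<and> card (post_critical_orbit f c) \<ge> 3) \<longrightarrow>
            Hausdorff_space (IMG_groupoid f c t))"
proof -
  interpret quadratic_pcf f c by unfold_locales (use assms in auto)
  show ?thesis
  proof (cases "\<exists>k\<ge>1. F k c = c")
    case True
    then obtain k where "k \<ge> 1" "F k c = c" by blast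
    then have "Hausdorff_space (IMG_groupoid f c t)" by (rule Hausdorff_periodic)
    moreover have "\<not> strictly_preperiodic f c" using True unfolding strictly_preperiodic_def by blast
    ultimately show ?thesis by blast
  next
    case False
    obtain M K where K: "K \<ge> 1" "F (M + K) v = F M v" by (rule eventually_periodic)
    have "F (n + K) c = F n c" if n: "n \<ge> Suc M" for n
    proof -
      obtain j where j: "n = Suc (j + M)" using n le_Suc_ex by (metis add.commute add_Suc)
      have "F (n + K) c = F (j + (M + K)) v" unfolding j F_v by (simp only: add_Suc add.assoc)
      also have "\<dots> = F (j + M) v" unfolding F_add K(2)[unfolded F_add] ..
      finally show ?thesis unfolding j F_v .
    qed
    then have "strictly_preperiodic f c"
      unfolding strictly_preperiodic_def using False K(1)
      by (intro conjI exI[of _ K] exI[of _ "Suc M"]) auto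
    then show ?thesis
      using Hausdorff_card_less_3[OF False, of t] not_Hausdorff_preperiodic[OF False _ assms(4)]
      by (meson not_le)
  qed
qed

end
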